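(* Let $m, n \in \mathbb{N}$ (positive integers) be such that $m \geq 3$, $n \mid m$ and $(m,n) \neq (3,1)$. Then the groups $\Gamma(m,n)$ and $\mathrm{P}\Gamma(m,n)$ are both free of rank $$1 + \frac{n m^2}{12} \prod_{\substack{p \mid m \\ p \text{ prime}}} \left(1 - \frac{1}{p^2}\right).$$
   Context: For positive integers $m, n$ with $n \mid m$, define the subgroup of $\mathrm{SL}_2(\mathbb{Z})$ $$\Gamma(m,n) := \left\{ \begin{pmatrix} a & b \\ c & d \end{pmatrix} \in \mathrm{SL}_2(\mathbb{Z}) \;\middle|\; a \equiv 1,\ b \equiv 0 \pmod m \ \text{ and } \ c \equiv 0,\ d \equiv 1 \pmod n \right\}.$$ $\mathrm{P}\Gamma(m,n)$ denotes the image of $\Gamma(m,n)$ in $\mathrm{PSL}_2(\mathbb{Z}) = \mathrm{SL}_2(\mathbb{Z})/\{\pm I\}$ under the natural projection. *)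

theory Defs
  imports
    "HOL-Analysis.Determinants"
    "HOL-Algebra.Coset"
    "HOL-Number_Theory.Cong"
    "HOL-Computational_Algebra.Primes"
begin

text \<open>The letter \<open>(x, True)\<close> stands for the generator \<open>x\<close> and \<open>(x, False)\<close> for its formal inverse.\<close>

type_synonym 'a letter = "'a \<times> bool"

definition letter_inv :: "'a letter \<Rightarrow> 'a letter"
  where "letter_inv l = (fst l, \<not> snd l)"

definition reduced :: "'a letter list \<Rightarrow> bool"
  where "reduced = successively (\<lambda>x y. y \<noteq> letter_inv x)"

fun push :: "'a letter \<Rightarrow> 'a letter list \<Rightarrow> 'a letter list"
  where
    "push x [] = [x]"
  | "push x (y # w) = (if y = letter_inv x then w else x # y # w)"

definition free_reduce :: "'a letter list \<Rightarrow> 'a letter list"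
  where "free_reduce w = foldr push w []"

definition free_group :: "'a set \<Rightarrow> 'a letter list monoid"
  where "free_group X =
    \<lparr>carrier = {w. reduced w \<and> set w \<subseteq> X \<times> UNIV},
     mult = (\<lambda>v w. free_reduce (v @ w)),
     one = []\<rparr>"

definition free_of_rank :: "('g, 'b) monoid_scheme \<Rightarrow> nat \<Rightarrow> bool"
  where "free_of_rank G r \<longleftrightarrow> group G \<and> G \<cong> free_group {..<r}"

lemma letter_inv_inv [simp]: "letter_inv (letter_inv x) = x"
  by (simp add: letter_inv_def)

lemma letter_inv_neq [simp]: "letter_inv x \<noteq> x" "x \<noteq> letter_inv x"
  by (auto simp: letter_inv_def prod_eq_iff)

lemma reduced_Nil [simp]: "reduced []"
  by (simp add: reduced_def)

lemma reduced_Cons: "reduced (x # w) \<longleftrightarrow> w = [] \<or> hd w \<noteq> letter_inv x \<and> reduced w"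
  by (simp add: reduced_def successively_Cons)

lemma reduced_push: "reduced w \<Longrightarrow> reduced (push x w)"
  by (cases w) (auto simp: reduced_Cons)

lemma reduced_foldr_push: "reduced w \<Longrightarrow> reduced (foldr push v w)"
  by (induction v) (auto intro: reduced_push)

lemma reduced_free_reduce: "reduced (free_reduce w)"
  by (simp add: free_reduce_def reduced_foldr_push)

lemma push_reduced: "reduced (x # w) \<Longrightarrow> push x w = x # w"
  by (cases w) (auto simp: reduced_Cons)

lemma push_cancel: "reduced w \<Longrightarrow> push x (push (letter_inv x) w) = w"
  by (cases w) (auto simp: push_reduced)

lemma free_reduce_id: "reduced w \<Longrightarrow> free_reduce w = w"
proof (induction w)
  case (Cons x w)
  then have "free_reduce w = w"
    by (auto simp: reduced_Cons free_reduce_def)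
  then show ?case
    using push_reduced[OF Cons.prems] by (simp add: free_reduce_def)
qed (simp add: free_reduce_def)

lemma foldr_push_push:
  assumes "reduced v" "reduced w"
  shows "foldr push (push x v) w = push x (foldr push v w)"
proof (cases v)
  case (Cons y u)
  then show ?thesis
    using assms push_cancel[OF reduced_foldr_push[OF assms(2)], of x u] by auto
qed simp

lemma foldr_push_free_reduce:
  "reduced w \<Longrightarrow> foldr push (free_reduce v) w = foldr push v w"
proof (induction v)
  case (Cons x v)
  then show ?case
    using foldr_push_push[OF reduced_free_reduce[of v] Cons.prems, of x]
    by (simp add: free_reduce_def)
qed (simp add: free_reduce_def)

lemma free_reduce_append: "free_reduce (v @ w) = foldr push v (free_reduce w)"
  by (simp add: free_reduce_def)

lemma set_push: "set (push x w) \<subseteq> insert x (set w)"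
  by (cases w) auto

lemma set_free_reduce: "set (free_reduce w) \<subseteq> set w"
proof (induction w)
  case (Cons x w)
  then show ?case using set_push[of x "free_reduce w"] by (auto simp: free_reduce_def)
qed (simp add: free_reduce_def)

lemma reduced_rev_inv: "reduced w \<Longrightarrow> reduced (rev (map letter_inv w))"
proof (induction w)
  case (Cons x w)
  then show ?case
    unfolding reduced_def
    by (cases w) (auto simp: successively_append_iff successively_Cons)
qed simp

lemma foldr_push_rev_inv:
  "reduced w \<Longrightarrow> foldr push (rev (map letter_inv v)) (foldr push v w) = w"
proof (induction v)
  case (Cons x v)
  then show ?case
    using push_cancel[OF reduced_foldr_push[OF Cons.prems], of "letter_inv x" v] by simp
qed simp

theorem group_free_group: "group (free_group X)"
proof (rule groupI)
  fix v w assume "v \<in> carrier (free_group X)" "w \<in> carrier (free_group X)"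
  then show "v \<otimes>\<^bsub>free_group X\<^esub> w \<in> carrier (free_group X)"
    using set_free_reduce[of "v @ w"] by (auto simp: free_group_def reduced_free_reduce)
next
  fix u v w
  assume "u \<in> carrier (free_group X)" "v \<in> carrier (free_group X)" "w \<in> carrier (free_group X)"
  then have "free_reduce v = v" "free_reduce w = w" "reduced w" "reduced v"
    by (auto simp: free_group_def free_reduce_id)
  then show "u \<otimes>\<^bsub>free_group X\<^esub> v \<otimes>\<^bsub>free_group X\<^esub> w
      = u \<otimes>\<^bsub>free_group X\<^esub> (v \<otimes>\<^bsub>free_group X\<^esub> w)"
    using foldr_push_free_reduce[of w "u @ v"]
    by (simp add: free_group_def free_reduce_append free_reduce_id reduced_foldr_push)
next
  fix w assume w: "w \<in> carrier (free_group X)"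
  let ?w = "rev (map letter_inv w)"
  have "?w \<in> carrier (free_group X)"
    using w reduced_rev_inv[of w] by (force simp: free_group_def letter_inv_def)
  moreover have "?w \<otimes>\<^bsub>free_group X\<^esub> w = \<one>\<^bsub>free_group X\<^esub>"
    using foldr_push_rev_inv[of "[]" w] by (simp add: free_group_def free_reduce_def)
  ultimately show "\<exists>v \<in> carrier (free_group X). v \<otimes>\<^bsub>free_group X\<^esub> w = \<one>\<^bsub>free_group X\<^esub>"
    by blast
qed (auto simp: free_group_def free_reduce_id)

definition SL2Z :: "(int ^ 2 ^ 2) monoid"
  where "SL2Z = \<lparr>carrier = {A. det A = 1}, mult = (**), one = mat 1\<rparr>"

definition PSL2Z :: "(int ^ 2 ^ 2) set monoid"
  where "PSL2Z = SL2Z Mod {mat 1, - mat 1}"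

definition PSL2Z_proj :: "int ^ 2 ^ 2 \<Rightarrow> (int ^ 2 ^ 2) set"
  where "PSL2Z_proj A = {mat 1, - mat 1} #>\<^bsub>SL2Z\<^esub> A"

definition Gamma_set :: "nat \<Rightarrow> nat \<Rightarrow> (int ^ 2 ^ 2) set"
  where "Gamma_set m n = {A \<in> carrier SL2Z.
    [A $ 1 $ 1 = 1] (mod int m) \<and> [A $ 1 $ 2 = 0] (mod int m) \<and>
    [A $ 2 $ 1 = 0] (mod int n) \<and> [A $ 2 $ 2 = 1] (mod int n)}"

definition Gamma_group :: "nat \<Rightarrow> nat \<Rightarrow> (int ^ 2 ^ 2) monoid"
  where "Gamma_group m n = SL2Z\<lparr>carrier := Gamma_set m n\<rparr>"

definition PGamma_group :: "nat \<Rightarrow> nat \<Rightarrow> (int ^ 2 ^ 2) set monoid"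
  where "PGamma_group m n = PSL2Z\<lparr>carrier := PSL2Z_proj ` Gamma_set m n\<rparr>"

definition adj2 :: "int ^ 2 ^ 2 \<Rightarrow> int ^ 2 ^ 2"
  where "adj2 A = vector [vector [A $ 2 $ 2, - (A $ 1 $ 2)], vector [- (A $ 2 $ 1), A $ 1 $ 1]]"

lemma mat2_eq_iff:
  "(A :: int ^ 2 ^ 2) = B \<longleftrightarrow>
     A $ 1 $ 1 = B $ 1 $ 1 \<and> A $ 1 $ 2 = B $ 1 $ 2 \<and> A $ 2 $ 1 = B $ 2 $ 1 \<and> A $ 2 $ 2 = B $ 2 $ 2"
  by (auto simp: vec_eq_iff forall_2)

lemma mat2_mult:
  "((A :: int ^ 2 ^ 2) ** B) $ i $ j = A $ i $ 1 * B $ 1 $ j + A $ i $ 2 * B $ 2 $ j"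
  by (simp add: matrix_matrix_mult_def sum_2)

lemma mat2_one:
  "(mat 1 :: int ^ 2 ^ 2) $ 1 $ 1 = 1" "(mat 1 :: int ^ 2 ^ 2) $ 1 $ 2 = 0"
  "(mat 1 :: int ^ 2 ^ 2) $ 2 $ 1 = 0" "(mat 1 :: int ^ 2 ^ 2) $ 2 $ 2 = 1"
  by (simp_all add: mat_def)

lemma adj2_nth:
  "adj2 A $ 1 $ 1 = A $ 2 $ 2" "adj2 A $ 1 $ 2 = - (A $ 1 $ 2)"
  "adj2 A $ 2 $ 1 = - (A $ 2 $ 1)" "adj2 A $ 2 $ 2 = A $ 1 $ 1"
  by (simp_all add: adj2_def)

lemma det_adj2: "det (adj2 A) = det A"
  by (simp add: det_2 adj2_nth algebra_simps)

lemma adj2_mult: "det A = 1 \<Longrightarrow> adj2 A ** A = mat 1"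
  by (simp add: mat2_eq_iff mat2_mult mat2_one adj2_nth det_2 algebra_simps)

theorem group_SL2Z: "group SL2Z"
proof (rule groupI)
  fix A assume "A \<in> carrier SL2Z"
  then show "\<exists>B \<in> carrier SL2Z. B \<otimes>\<^bsub>SL2Z\<^esub> A = \<one>\<^bsub>SL2Z\<^esub>"
    by (intro bexI[of _ "adj2 A"]) (auto simp: SL2Z_def adj2_mult det_adj2)
qed (auto simp: SL2Z_def det_mul matrix_mul_assoc)

lemma inv_SL2Z: "A \<in> carrier SL2Z \<Longrightarrow> inv\<^bsub>SL2Z\<^esub> A = adj2 A"
  using group.inv_equality[OF group_SL2Z, of "adj2 A" A]
  by (simp add: SL2Z_def adj2_mult det_adj2)

lemma subgroup_pm_one: "subgroup {mat 1, - mat 1} SL2Z"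
proof (rule group.subgroupI[OF group_SL2Z])
  show *: "{mat 1, - mat 1} \<subseteq> carrier SL2Z"
    by (auto simp: SL2Z_def det_2 mat2_one)
  fix A assume A: "A \<in> {mat 1, - mat 1 :: int ^ 2 ^ 2}"
  then have "A \<in> carrier SL2Z" using * by blast
  then show "inv\<^bsub>SL2Z\<^esub> A \<in> {mat 1, - mat 1}"
    using A by (auto simp: inv_SL2Z mat2_eq_iff adj2_nth mat2_one)
  fix B assume "B \<in> {mat 1, - mat 1 :: int ^ 2 ^ 2}"
  then show "A \<otimes>\<^bsub>SL2Z\<^esub> B \<in> {mat 1, - mat 1}"
    using A by (auto simp: SL2Z_def mat2_eq_iff mat2_mult mat2_one)
qed simp

theorem normal_pm_one: "{mat 1, - mat 1} \<lhd> SL2Z"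
proof (rule group.normalI[OF group_SL2Z subgroup_pm_one], rule ballI)
  fix A assume "A \<in> carrier SL2Z"
  show "{mat 1, - mat 1} #>\<^bsub>SL2Z\<^esub> A = A <#\<^bsub>SL2Z\<^esub> {mat 1, - mat 1}"
    by (auto simp: r_coset_def l_coset_def SL2Z_def mat2_eq_iff mat2_mult mat2_one)
qed

theorem group_PSL2Z: "group PSL2Z"
  unfolding PSL2Z_def by (rule normal.factorgroup_is_group[OF normal_pm_one])

lemma group_hom_PSL2Z_proj: "group_hom SL2Z PSL2Z PSL2Z_proj"
  using normal.r_coset_hom_Mod[OF normal_pm_one] group_SL2Z group_PSL2Z
  unfolding group_hom_def group_hom_axioms_def PSL2Z_def PSL2Z_proj_def by blast

theorem subgroup_Gamma_set:
  assumes "n dvd m"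
  shows "subgroup (Gamma_set m n) SL2Z"
proof (rule group.subgroupI[OF group_SL2Z])
  have mono: "[x = y] (mod int n)" if "[x = y] (mod int m)" for x y
    using that assms cong_dvd_modulus int_dvd_int_iff by blast
  show "Gamma_set m n \<subseteq> carrier SL2Z"
    by (auto simp: Gamma_set_def)
  have "mat 1 \<in> Gamma_set m n"
    by (simp add: Gamma_set_def SL2Z_def mat2_one)
  then show "Gamma_set m n \<noteq> {}"
    by blast
  fix A assume A: "A \<in> Gamma_set m n"
  have a: "[A $ 1 $ 1 = 1] (mod int m)" "[A $ 1 $ 2 = 0] (mod int m)"
    "[A $ 2 $ 1 = 0] (mod int n)" "[A $ 2 $ 2 = 1] (mod int n)"
    and dA: "A $ 1 $ 1 * A $ 2 $ 2 - A $ 1 $ 2 * A $ 2 $ 1 = 1"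
    using A by (auto simp: Gamma_set_def SL2Z_def det_2)
  have "[A $ 1 $ 1 * A $ 2 $ 2 - A $ 1 $ 2 * A $ 2 $ 1 = 1 * A $ 2 $ 2 - 0 * A $ 2 $ 1] (mod int m)"
    by (intro cong_diff cong_mult cong_refl a)
  then have "[A $ 2 $ 2 = 1] (mod int m)"
    using dA by (simp add: cong_sym_eq)
  moreover have "[- (A $ 1 $ 2) = 0] (mod int m)" "[- (A $ 2 $ 1) = 0] (mod int n)"
    using a by (simp_all add: cong_0_iff)
  ultimately show "inv\<^bsub>SL2Z\<^esub> A \<in> Gamma_set m n"
    using A mono[OF a(1)] inv_SL2Z[of A]
    by (simp add: Gamma_set_def adj2_nth det_adj2) (simp add: SL2Z_def det_adj2)
  fix B assume B: "B \<in> Gamma_set m n"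
  have b: "[B $ 1 $ 1 = 1] (mod int m)" "[B $ 1 $ 2 = 0] (mod int m)"
    "[B $ 2 $ 1 = 0] (mod int n)" "[B $ 2 $ 2 = 1] (mod int n)"
    using B by (auto simp: Gamma_set_def)
  have "[A $ 1 $ 1 * B $ 1 $ 1 + A $ 1 $ 2 * B $ 2 $ 1 = 1 * 1 + 0 * B $ 2 $ 1] (mod int m)"
    "[A $ 1 $ 1 * B $ 1 $ 2 + A $ 1 $ 2 * B $ 2 $ 2 = A $ 1 $ 1 * 0 + 0 * B $ 2 $ 2] (mod int m)"
    "[A $ 2 $ 1 * B $ 1 $ 1 + A $ 2 $ 2 * B $ 2 $ 1 = 0 * B $ 1 $ 1 + A $ 2 $ 2 * 0] (mod int n)"
    "[A $ 2 $ 1 * B $ 1 $ 2 + A $ 2 $ 2 * B $ 2 $ 2 = 0 * B $ 1 $ 2 + 1 * 1] (mod int n)"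
    by (intro cong_add cong_mult cong_refl a b)+
  moreover have "det (A ** B) = 1"
    using A B by (simp add: Gamma_set_def SL2Z_def det_mul)
  ultimately show "A \<otimes>\<^bsub>SL2Z\<^esub> B \<in> Gamma_set m n"
    by (simp add: Gamma_set_def SL2Z_def mat2_mult)
qed

theorem subgroup_PGamma:
  assumes "n dvd m"
  shows "subgroup (PSL2Z_proj ` Gamma_set m n) PSL2Z"
  by (rule group_hom.subgroup_img_is_subgroup[OF group_hom_PSL2Z_proj subgroup_Gamma_set[OF assms]])

theorem
  assumes "n dvd m"
  shows group_Gamma_group: "group (Gamma_group m n)"
    and group_PGamma_group: "group (PGamma_group m n)"
  unfolding Gamma_group_def PGamma_group_def
  by (intro group.subgroup_imp_group group_SL2Z group_PSL2Z
        subgroup_Gamma_set[OF assms] subgroup_PGamma[OF assms])+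

end

theory Submission
  imports Defs
begin

text \<open>The group \<open>PSL2Z\<close> is the free product of its subgroups generated by \<open>s\<close> of order 2 and \<open>t\<close> of
  order 3. For a subgroup \<open>H\<close> of finite index that contains no conjugate of \<open>s\<close> or \<open>t\<close>, the orbits of
  \<open>t\<close> and of \<open>s\<close> on the cosets of \<open>H\<close> are the vertices and edges of a finite connected cubic graph.
  Sending the edges of a spanning tree to 1 and the remaining edges to free generators lets \<open>s\<close> and
  \<open>t\<close>, hence \<open>PSL2Z\<close>, act on the product of the coset space with a free group; this yields a
  homomorphism from \<open>H\<close> to the free group, whose inverse sends a generator to the loop through its
  edge. So \<open>H\<close> is free of rank one plus a sixth of its index. The group \<open>Gamma_set m n\<close> does not
  contain \<open>- mat 1\<close> and, by a trace argument, its image contains no conjugate of \<open>s\<close> or \<open>t\<close>; its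
  index is the number of top rows modulo \<open>m\<close> times \<open>n\<close>.\<close>

section \<open>Torsion-free subgroups of the free product of cyclic groups of orders 2 and 3\<close>

text \<open>Words in the two generators of orders 2 and 3, encoded as \<open>True\<close> and \<open>False\<close>.\<close>

inductive modular_eq :: "bool list \<Rightarrow> bool list \<Rightarrow> bool"
  where
    equiv_refl: "modular_eq w w"
  | equiv_sym: "modular_eq v w \<Longrightarrow> modular_eq w v"
  | equiv_trans: "modular_eq u v \<Longrightarrow> modular_eq v w \<Longrightarrow> modular_eq u w"
  | square: "modular_eq (u @ [True, True] @ v) (u @ v)"
  | cube: "modular_eq (u @ [False, False, False] @ v) (u @ v)"

lemma modular_eq_append_cong: "modular_eq v w \<Longrightarrow> modular_eq (x @ v @ y) (x @ w @ y)"
proof (induction rule: modular_eq.induct)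
  case (square u v)
  show ?case using modular_eq.square[of "x @ u" "v @ y"] by simp
next
  case (cube u v)
  show ?case using modular_eq.cube[of "x @ u" "v @ y"] by simp
qed (auto intro: modular_eq.intros)

text \<open>Two maps whose square, respectively cube, is the identity give an action of the
  presented group. The covering below is built as such an action.\<close>

lemma fold_modular_eq:
  assumes "modular_eq v w" "f True \<circ> f True = id" "f False \<circ> f False \<circ> f False = id"
  shows "fold f v = fold f w"
  using assms by (induction rule: modular_eq.induct) (auto simp: fun_eq_iff)

definition word_eval :: "('g, 'b) monoid_scheme \<Rightarrow> 'g \<Rightarrow> 'g \<Rightarrow> bool list \<Rightarrow> 'g"
  where "word_eval G s t w = foldr (\<lambda>b g. (if b then s else t) \<otimes>\<^bsub>G\<^esub> g) w \<one>\<^bsub>G\<^esub>"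

definition letter_eval :: "('g, 'b) monoid_scheme \<Rightarrow> ('a \<Rightarrow> 'g) \<Rightarrow> 'a letter \<Rightarrow> 'g"
  where "letter_eval G f l = (if snd l then f (fst l) else inv\<^bsub>G\<^esub> (f (fst l)))"

definition free_eval :: "('g, 'b) monoid_scheme \<Rightarrow> ('a \<Rightarrow> 'g) \<Rightarrow> 'a letter list \<Rightarrow> 'g"
  where "free_eval G f w = foldr (\<lambda>l g. letter_eval G f l \<otimes>\<^bsub>G\<^esub> g) w \<one>\<^bsub>G\<^esub>"

lemma free_eval_Nil [simp]: "free_eval G f [] = \<one>\<^bsub>G\<^esub>"
  and free_eval_Cons [simp]: "free_eval G f (l # w) = letter_eval G f l \<otimes>\<^bsub>G\<^esub> free_eval G f w"
  by (simp_all add: free_eval_def)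

context group
begin

lemma letter_eval_closed:
  "f ` fst ` set [l] \<subseteq> carrier G \<Longrightarrow> letter_eval G f l \<in> carrier G"
  by (auto simp: letter_eval_def)

lemma letter_eval_inv:
  "f (fst l) \<in> carrier G \<Longrightarrow> letter_eval G f (letter_inv l) = inv (letter_eval G f l)"
  by (auto simp: letter_eval_def letter_inv_def)

lemma free_eval_closed: "f ` fst ` set w \<subseteq> carrier G \<Longrightarrow> free_eval G f w \<in> carrier G"
  by (induction w) (auto simp: letter_eval_def)

lemma free_eval_append:
  "f ` fst ` set v \<subseteq> carrier G \<Longrightarrow> f ` fst ` set w \<subseteq> carrier G \<Longrightarrow>
    free_eval G f (v @ w) = free_eval G f v \<otimes> free_eval G f w"
  by (induction v) (auto simp: letter_eval_def free_eval_closed m_assoc)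

lemma free_eval_push:
  assumes "f ` fst ` set (x # w) \<subseteq> carrier G"
  shows "free_eval G f (push x w) = letter_eval G f x \<otimes> free_eval G f w"
proof (cases w)
  case (Cons y u)
  have *: "letter_eval G f x \<in> carrier G" "free_eval G f u \<in> carrier G"
    using assms Cons by (auto intro!: letter_eval_closed free_eval_closed)
  then show ?thesis
    using assms Cons by (auto simp: letter_eval_inv m_assoc[symmetric])
qed simp

text \<open>Cancelling a letter against its inverse keeps the value; hence \<open>free_eval\<close>
  respects the product of a free group, which is concatenation followed by reduction.\<close>

lemma free_eval_free_reduce:
  "f ` fst ` set w \<subseteq> carrier G \<Longrightarrow> free_eval G f (free_reduce w) = free_eval G f w"
proof (induction w)
  case (Cons x w)
  then have "f ` fst ` set (x # free_reduce w) \<subseteq> carrier G"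
    using set_free_reduce[of w] by fastforce
  with Cons show ?case
    using free_eval_push[of f x "free_reduce w"] by (simp add: free_reduce_def)
qed (simp add: free_reduce_def)

end

text \<open>The two assumptions on \<open>word_eval\<close> say that \<open>s\<close> and
  \<open>t\<close> generate and that every relation follows from s^2 = t^3 = 1: the group is the
  free product of cyclic groups of orders 2 and 3.\<close>

locale modular_presentation = group +
  fixes s t :: 'a
  assumes s_closed [simp]: "s \<in> carrier G" and t_closed [simp]: "t \<in> carrier G"
    and s_square: "s \<otimes> s = \<one>" and t_cube: "t \<otimes> t \<otimes> t = \<one>"
    and word_eval_surj: "g \<in> carrier G \<Longrightarrow> \<exists>w. word_eval G s t w = g"
    and word_eval_one: "word_eval G s t w = \<one> \<Longrightarrow> modular_eq w []"
begin

abbreviation "ev \<equiv> word_eval G s t"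

lemma ev_Nil [simp]: "ev [] = \<one>"
  and ev_Cons [simp]: "ev (b # w) = (if b then s else t) \<otimes> ev w"
  by (simp_all add: word_eval_def)

lemma ev_closed [simp]: "ev w \<in> carrier G"
  by (induction w) auto

lemma ev_append: "ev (v @ w) = ev v \<otimes> ev w"
  by (induction v) (auto simp: m_assoc)

text \<open>Let \<open>w\<close> spell the inverse of the common value. Then \<open>w @ v\<close>
  and \<open>u @ w\<close> are trivial, so \<open>u @ w @ v\<close> is equivalent to
  \<open>u\<close> and to \<open>v\<close>.\<close>

lemma modular_eq_if_ev_eq:
  assumes "ev u = ev v"
  shows "modular_eq u v"
proof -
  obtain w where w: "ev w = inv (ev v)"
    using word_eval_surj[of "inv (ev v)"] by auto
  have "modular_eq (w @ v) []" "modular_eq (u @ w) []"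
    using w assms by (auto intro!: word_eval_one simp: ev_append)
  then have "modular_eq (u @ (w @ v)) (u @ [])" "modular_eq ((u @ w) @ v) ([] @ v)"
    using modular_eq_append_cong[of "w @ v" "[]" u "[]"] modular_eq_append_cong[of "u @ w" "[]" "[]" v]
    by auto
  then show ?thesis
    by (metis append.assoc append_Nil append_Nil2 modular_eq.equiv_sym modular_eq.equiv_trans)
qed

end

text \<open>The coset \<open>H #> g\<close> is fixed by \<open>s\<close> exactly when g s g^-1 lies
  in \<open>H\<close>, and likewise for \<open>t\<close>. So no conjugate of \<open>s\<close> or
  \<open>t\<close> lies in \<open>H\<close>, and their orbits on cosets have full size 2 and
  3.\<close>

locale modular_free_subgroup = modular_presentation +
  fixes H
  assumes sub: "subgroup H G" and fin: "finite (rcosets H)"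
    and s_free: "x \<in> rcosets H \<Longrightarrow> x #> s \<noteq> x"
    and t_free: "x \<in> rcosets H \<Longrightarrow> x #> t \<noteq> x"
begin

abbreviation "X \<equiv> rcosets H"

lemma coset_closed: "x \<in> X \<Longrightarrow> x \<subseteq> carrier G"
  by (rule subgroup.rcosets_carrier[OF sub is_group])

lemma coset_mult: "x \<in> X \<Longrightarrow> g \<in> carrier G \<Longrightarrow> h \<in> carrier G \<Longrightarrow> x #> g #> h = x #> (g \<otimes> h)"
  by (rule coset_mult_assoc[OF coset_closed])

lemma coset_one: "x \<in> X \<Longrightarrow> x #> \<one> = x"
  by (simp add: coset_closed)

lemma coset_mult_closed:
  assumes "x \<in> X" "g \<in> carrier G"
  shows "x #> g \<in> X"
proof -
  obtain h where h: "h \<in> carrier G" "x = H #> h"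
    using assms by (auto simp: RCOSETS_def)
  show ?thesis
    unfolding h using h assms coset_mult_assoc[OF subgroup.subset[OF sub], of h g]
    by (auto simp: RCOSETS_def)
qed

lemma H_coset: "H \<in> X"
  by (rule subgroup.subgroup_in_rcosets[OF sub is_group])

lemma s_s: "x \<in> X \<Longrightarrow> x #> s #> s = x"
  by (simp add: coset_mult s_square coset_one)

lemma t_t_t: "x \<in> X \<Longrightarrow> x #> t #> t #> t = x"
  by (simp add: coset_mult coset_mult_closed m_assoc[symmetric] t_cube coset_one)

lemma st_closed: "x \<in> X \<Longrightarrow> x #> s \<in> X" "x \<in> X \<Longrightarrow> x #> t \<in> X"
  by (simp_all add: coset_mult_closed)

lemma t_t_free: "x \<in> X \<Longrightarrow> x #> t #> t \<noteq> x"
  using t_free[of x] t_t_t[of x] by metis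

section \<open>Spanning trees of the coset graph\<close>

definition orbit3 where "orbit3 x = {x, x #> t, x #> t #> t}"

text \<open>The value at \<open>x\<close> is propagated around the \<open>t\<close>-orbit, so that
  representatives become compatible with right multiplication by \<open>t\<close>.\<close>

definition upd3 where "upd3 r x g = r(x := g, x #> t := g \<otimes> t, x #> t #> t := g \<otimes> t \<otimes> t)"

text \<open>Growing a spanning tree of the graph whose vertices are the orbits of \<open>t\<close> on the cosets and
  whose edges are the orbits of \<open>s\<close>: the cosets reached so far, the edges used, and a representative
  of each coset reached.\<close>

inductive spanning :: "'a set set \<Rightarrow> 'a set set \<Rightarrow> ('a set \<Rightarrow> 'a) \<Rightarrow> bool"
  where
    root: "spanning (orbit3 H) {} (upd3 (\<lambda>_. \<one>) H \<one>)"
  | grow: "spanning D T r \<Longrightarrow> x \<in> D \<Longrightarrow> x #> s \<notin> D \<Longrightarrow>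
      spanning (D \<union> orbit3 (x #> s)) (T \<union> {x, x #> s}) (upd3 r (x #> s) (r x \<otimes> s))"

lemma orbit3_props:
  assumes "x \<in> X"
  shows "orbit3 x \<subseteq> X" "card (orbit3 x) = 3" "y \<in> orbit3 x \<Longrightarrow> y #> t \<in> orbit3 x"
    "finite (orbit3 x)"
proof -
  have "x #> t \<noteq> x #> t #> t" using t_free[of "x #> t"] assms by (metis st_closed(2))
  then show "card (orbit3 x) = 3"
    unfolding orbit3_def using t_free[OF assms] t_t_free[OF assms] by (auto simp: card_insert_if)
qed (use assms in \<open>auto simp: orbit3_def st_closed t_t_t\<close>)

lemma upd3_spec:
  assumes "x \<in> X" "g \<in> carrier G" "H #> g = x" "y \<in> orbit3 x"
  shows "upd3 r x g y \<in> carrier G" "H #> upd3 r x g y = y"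
    "upd3 r x g (y #> t) = upd3 r x g y \<otimes> t"
proof -
  have ne: "x #> t \<noteq> x #> t #> t" "x #> t \<noteq> x" "x #> t #> t \<noteq> x"
    using t_free t_t_free assms(1) by (metis st_closed(2))+
  have "H #> (g \<otimes> t) = x #> t" "H #> (g \<otimes> t \<otimes> t) = x #> t #> t"
    using assms by (metis coset_mult H_coset t_closed m_closed)+
  then show "upd3 r x g y \<in> carrier G" "H #> upd3 r x g y = y"
    using assms ne by (auto simp: upd3_def orbit3_def)
  have "g \<otimes> t \<otimes> t \<otimes> t = g"
    using assms t_cube by (simp add: m_assoc)
  then show "upd3 r x g (y #> t) = upd3 r x g y \<otimes> t"
    using assms(4) ne unfolding orbit3_def upd3_def by (auto simp: t_t_t[OF assms(1)])
qed

lemma upd3_other: "y \<notin> orbit3 x \<Longrightarrow> upd3 r x g y = r y"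
  by (simp add: upd3_def orbit3_def)

lemma upd3_self: "x \<in> X \<Longrightarrow> upd3 r x g x = g"
  using t_free[of x] t_t_free[of x] by (auto simp: upd3_def)

text \<open>A tree has one edge fewer than vertices; a vertex consists of three cosets and an edge
  of two, whence \<open>3 * card T + 6 = 2 * card D\<close>. Compatibility of \<open>r\<close> with
  \<open>t\<close> holds on all of \<open>D\<close>; with \<open>s\<close> it is claimed only along
  tree edges.\<close>

lemma spanning_props:
  assumes "spanning D T r"
  shows "D \<subseteq> X \<and> H \<in> D \<and> T \<subseteq> D \<and> r H = \<one> \<and> 3 * card T + 6 = 2 * card D \<and>
    (\<forall>y\<in>T. y #> s \<in> T \<and> r (y #> s) = r y \<otimes> s) \<and>
    (\<forall>y\<in>D. y #> t \<in> D \<and> r y \<in> carrier G \<and> H #> r y = y \<and> r (y #> t) = r y \<otimes> t)"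
  using assms
proof induction
  case root
  have "H #> \<one> = H" using coset_one[OF H_coset] .
  then show ?case
    using orbit3_props[OF H_coset] upd3_spec[OF H_coset one_closed] upd3_self[OF H_coset]
    by (auto simp: orbit3_def)
next
  case (grow D T r x)
  let ?y = "x #> s" and ?r = "upd3 r (x #> s) (r x \<otimes> s)"
  have x: "x \<in> X" and y: "?y \<in> X" using grow st_closed by auto
  have sub3: "z #> t \<in> D" if "z \<in> D" for z using grow that by blast
  \<comment> \<open>\<open>D\<close> is a union of \<open>t\<close>-orbits, so if it met the orbit
    of \<open>?y\<close> it would contain \<open>?y\<close>.\<close>
  have disj: "z \<notin> D" if "z \<in> orbit3 ?y" for z
  proof
    assume z: "z \<in> D"
    then have "z #> t \<in> D" "z #> t #> t \<in> D" using sub3 by blast+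
    moreover have "?y \<in> {z, z #> t, z #> t #> t}"
      using that t_t_t[OF y] by (auto simp: orbit3_def)
    ultimately show False using z grow.hyps by auto
  qed
  have old: "?r z = r z" if "z \<in> D" for z
    using that disj by (auto intro: upd3_other)
  have rx: "r x \<otimes> s \<in> carrier G" "H #> (r x \<otimes> s) = ?y"
    using grow.IH grow.hyps(2) s_closed coset_mult[OF H_coset, of "r x" s] by auto
  have new: "?r z \<in> carrier G" "H #> ?r z = z" "?r (z #> t) = ?r z \<otimes> t" "z #> t \<in> orbit3 ?y"
    if "z \<in> orbit3 ?y" for z
    using upd3_spec[OF y rx that] orbit3_props(3)[OF y that] by auto
  have finD: "finite D" "finite T"
    using grow.IH fin finite_subset by metis+
  have cD: "card (D \<union> orbit3 ?y) = card D + 3"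
    using card_Un_disjoint[OF finD(1) orbit3_props(4)[OF y]] disj orbit3_props(2)[OF y] by auto
  have "x \<notin> T" "?y \<notin> T"
    using grow.IH grow.hyps by auto
  then have cT: "card (T \<union> {x, ?y}) = card T + 2"
    using finD s_free[OF x] by (auto simp: card_insert_if)
  have yo: "?y \<in> orbit3 ?y" by (simp add: orbit3_def)
  have T: "z #> s \<in> T \<union> {x, ?y} \<and> ?r (z #> s) = ?r z \<otimes> s" if z: "z \<in> T \<union> {x, ?y}" for z
  proof -
    have "r x \<otimes> s \<otimes> s = r x" using grow.IH grow.hyps(2) s_square by (simp add: m_assoc)
    moreover have "z #> s \<in> T" "r (z #> s) = r z \<otimes> s" "z \<in> D" "z #> s \<in> D" if "z \<in> T"
      using that grow.IH by blast+
    ultimately show ?thesis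
      using z grow.hyps(2) old upd3_self[OF y] s_s[OF x] by auto
  qed
  have D: "z #> t \<in> D \<union> orbit3 ?y \<and> ?r z \<in> carrier G \<and> H #> ?r z = z \<and> ?r (z #> t) = ?r z \<otimes> t"
    if z: "z \<in> D \<union> orbit3 ?y" for z
  proof (cases "z \<in> D")
    case True
    then show ?thesis using grow.IH old sub3 by auto
  next
    case False
    then show ?thesis using z new by auto
  qed
  show ?case
    using grow.IH grow.hyps(2) old cD cT orbit3_props(1)[OF y] yo
    by (intro conjI ballI T[THEN conjunct1] T[THEN conjunct2] D) auto
qed

text \<open>A reached set of maximal size is closed under \<open>s\<close> as well as
  \<open>t\<close>. These generate the group, which is transitive on the cosets, so everything is
  reached.\<close>

lemma spanning_exists: "\<exists>T r. spanning X T r"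
proof -
  define P where "P = (\<lambda>D. \<exists>T r. spanning D T r)"
  have "P (orbit3 H)" using spanning.root by (auto simp: P_def)
  moreover have bound: "D \<subseteq> X" if "P D" for D
    using that spanning_props unfolding P_def by metis
  ultimately obtain D where D: "P D" "\<And>E. P E \<Longrightarrow> card E \<le> card D"
    using ex_has_greatest_nat[of P "orbit3 H" card "card X + 1"] card_mono[OF fin]
    by (metis less_Suc_eq_le Suc_eq_plus1)
  then obtain T r where sp: "spanning D T r" by (auto simp: P_def)
  note sp' = spanning_props[OF sp]
  have s: "x #> s \<in> D" if x: "x \<in> D" for x
  proof (rule ccontr)
    assume n: "x #> s \<notin> D"
    have "P (D \<union> orbit3 (x #> s))" using spanning.grow[OF sp x n] by (auto simp: P_def)
    then have "card (D \<union> orbit3 (x #> s)) \<le> card D" "finite (D \<union> orbit3 (x #> s))"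
      using D(2) bound fin finite_subset by blast+
    then have "D \<union> orbit3 (x #> s) = D"
      by (metis card_seteq sup_ge1)
    then show False using n by (auto simp: orbit3_def)
  qed
  have "x #> ev w \<in> D" if "x \<in> D" for x w
    using that
  proof (induction w arbitrary: x)
    case (Cons b w)
    have "x #> (if b then s else t) \<in> D" using s sp' Cons by auto
    from Cons.IH[OF this] show ?case using Cons.prems sp' coset_mult[of x] by auto
  qed (use sp' coset_one in auto)
  then have "H #> g \<in> D" if "g \<in> carrier G" for g
    using word_eval_surj[OF that] sp' by auto
  then have "X \<subseteq> D" by (auto simp: RCOSETS_def)
  then show ?thesis using sp sp' by (metis subset_antisym)
qed

text \<open>The graph has |X|/3 vertices and |X|/2 edges, so |X|/2 - (|X|/3 - 1) = |X|/6 + 1 edges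
  lie outside the tree; these index the free generators.\<close>

lemma free_of_rank_subgroup:
  "\<exists>r. 6 * r = card X + 6 \<and> free_of_rank (G\<lparr>carrier := H\<rparr>) r"
proof -
  obtain T rep where sp: "spanning X T rep" using spanning_exists by blast
  note sp' = spanning_props[OF sp]
  have rep: "rep x \<in> carrier G" "H #> rep x = x" "rep (x #> t) = rep x \<otimes> t" if "x \<in> X" for x
    using that sp' by auto
  have repH: "rep H = \<one>" using sp' by blast

  \<comment> \<open>Counting the edges outside the tree\<close>
  define E where "E = (\<lambda>x. {x, x #> s}) ` (X - T)"
  have TX: "T \<subseteq> X" "finite T" using sp' fin finite_subset by auto
  have Ts: "x #> s \<in> T \<longleftrightarrow> x \<in> T" if "x \<in> X" for x
    using sp' s_s[OF that] by metis
  have pair_eq: "{y, y #> s} = {x, x #> s} \<longleftrightarrow> y = x \<or> y = x #> s" if "x \<in> X" for x y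
    using s_s[OF that] by (auto simp: doubleton_eq_iff)
  have "card (X - T) = (\<Sum>e\<in>E. card {x \<in> X - T. {x, x #> s} = e})"
    using sum.image_gen[of "X - T" "\<lambda>_. 1::nat" "\<lambda>x. {x, x #> s}"] fin
    by (simp add: E_def)
  also have "\<dots> = (\<Sum>e\<in>E. 2)"
  proof (rule sum.cong)
    fix e assume "e \<in> E"
    then obtain x where x: "x \<in> X - T" "e = {x, x #> s}" by (auto simp: E_def)
    have "{y \<in> X - T. {y, y #> s} = e} = {x, x #> s}"
      using x pair_eq[of x] Ts[of x] st_closed by auto
    then show "card {y \<in> X - T. {y, y #> s} = e} = 2"
      using s_free[of x] x by (metis DiffD1 card_2_iff)
  qed simp
  finally have "card X - card T = 2 * card E"
    using TX fin by (simp add: card_Diff_subset)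
  moreover have "3 * card T + 6 = 2 * card X" using sp' by blast
  moreover have "card T \<le> card X" using TX fin card_mono by blast
  ultimately have cE: "6 * card E = card X + 6" by linarith

  \<comment> \<open>Edge labels and the corresponding loops\<close>
  define r where "r = card E"
  have finE: "finite E" using fin by (simp add: E_def)
  then obtain b where b: "bij_betw b E {..<r}"
    using ex_bij_betw_finite_nat[of E] by (auto simp: atLeast0LessThan r_def)
  \<comment> \<open>An arbitrary orientation of each edge, given by its starting coset.\<close>
  define ori where "ori e = (SOME x. x \<in> e)" for e :: "'a set set"
  \<comment> \<open>Crossing an edge against its orientation reads the inverse letter, so the labels
    of its two directions cancel; tree edges read nothing.\<close>
  define label where "label x = (if x \<in> T then [] else
    [(b {x, x #> s}, x = ori {x, x #> s})])" for x
  \<comment> \<open>The loop that runs in the tree from \<open>H\<close> to the start of the edge,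
    crosses the edge and returns in the tree.\<close>
  define gen where "gen i = (let x = ori (inv_into E b i) in
    rep x \<otimes> s \<otimes> inv (rep (x #> s)))" for i
  have ori: "ori {x, x #> s} = x \<or> ori {x, x #> s} = x #> s" for x
    unfolding ori_def using someI[of "\<lambda>y. y \<in> {x, x #> s}" x] by auto
  have E_in: "{x, x #> s} \<in> E" if "x \<in> X - T" for x
    using that by (auto simp: E_def)
  have b_lt: "b e < r" if "e \<in> E" for e
    using b that by (auto simp: bij_betw_def)
  have inv_b: "inv_into E b (b e) = e" if "e \<in> E" for e
    using b that by (auto simp: bij_betw_def)
  let ?F = "free_group {..<r}"
  interpret F: group ?F by (rule group_free_group)
  have F_mult: "v \<otimes>\<^bsub>?F\<^esub> w = free_reduce (v @ w)" for v w
    by (simp add: free_group_def)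
  have F_one: "\<one>\<^bsub>?F\<^esub> = []" by (simp add: free_group_def)
  have F_letters: "fst ` set w \<subseteq> {..<r}" if "w \<in> carrier ?F" for w
    using that by (auto simp: free_group_def)
  have label_closed: "label x \<in> carrier ?F" if "x \<in> X" for x
    using that by (auto simp: label_def free_group_def reduced_Cons E_in b_lt)
  have label_inv: "label x \<otimes>\<^bsub>?F\<^esub> label (x #> s) = \<one>\<^bsub>?F\<^esub>" if "x \<in> X" for x
  proof (cases "x \<in> T")
    case True
    then show ?thesis using Ts[OF that] by (simp add: label_def F_mult F_one free_reduce_def)
  next
    case False
    have "{x #> s, x} = {x, x #> s}" by auto
    then show ?thesis using False Ts[OF that] ori[of x] s_free[OF that]
      by (auto simp: label_def F_mult F_one free_reduce_def s_s[OF that] letter_inv_def)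
  qed
  have gen_closed: "gen i \<in> carrier G" if i: "i < r" for i
  proof -
    obtain e where e: "e \<in> E" "b e = i"
      using b i by (metis bij_betwE bij_betw_inv_into bij_betw_inv_into_right lessThan_iff)
    then obtain x where "x \<in> X - T" "e = {x, x #> s}" by (auto simp: E_def)
    then have "ori e \<in> X" using ori[of x] st_closed(1)[of x] by auto
    then show ?thesis
      using inv_b[OF e(1)] e(2) rep st_closed by (simp add: gen_def Let_def)
  qed
  let ?ev = "free_eval G gen"
  have letters_closed: "gen ` fst ` set w \<subseteq> carrier G" if "w \<in> carrier ?F" for w
    using F_letters[OF that] gen_closed by blast
  have psi_closed: "?ev w \<in> carrier G" if "w \<in> carrier ?F" for w
    by (rule free_eval_closed[OF letters_closed[OF that]])
  have psi_mult: "?ev (v \<otimes>\<^bsub>?F\<^esub> w) = ?ev v \<otimes> ?ev w" if "v \<in> carrier ?F" "w \<in> carrier ?F" for v w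
  proof -
    have "gen ` fst ` set (v @ w) \<subseteq> carrier G" using letters_closed that by auto
    then show ?thesis
      using free_eval_free_reduce[of gen "v @ w"] free_eval_append[of gen v w] letters_closed that
      by (simp add: F_mult)
  qed
  \<comment> \<open>On a tree edge the loop is trivial because \<open>rep\<close> is compatible with
    \<open>s\<close> there; crossing backwards gives the inverse loop because \<open>s\<close> is
    its own inverse.\<close>
  have psi_label: "?ev (label x) = rep x \<otimes> s \<otimes> inv (rep (x #> s))" if x: "x \<in> X" for x
  proof (cases "x \<in> T")
    case True
    then have "rep (x #> s) = rep x \<otimes> s" using sp' by blast
    then show ?thesis using True rep[OF x] by (simp add: label_def)
  next
    case False
    let ?e = "{x, x #> s}"
    have xs: "x #> s \<in> X" using x st_closed by blast
    have e: "inv_into E b (b ?e) = ?e" using inv_b E_in False x by auto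
    have si: "inv s = s" by (simp add: inv_equality[OF s_square])
    consider "ori ?e = x" | "ori ?e = x #> s" "x \<noteq> ori ?e" using ori[of x] s_free[OF x] by auto
    then show ?thesis
    proof cases
      case 1
      then show ?thesis using False e rep[OF x] rep[OF xs]
        by (simp add: label_def letter_eval_def gen_def)
    next
      case 2
      then show ?thesis using False e rep[OF x] rep[OF xs] si
        by (simp add: label_def letter_eval_def gen_def s_s[OF x] inv_mult_group m_assoc)
    qed
  qed
  text \<open>The monodromy action on the covering with fibre the free group; acting on the base point
    \<open>(H, [])\<close> reads off the free word of an element of \<open>H\<close>.\<close>
  define step where "step c = (\<lambda>(x, f). if x \<in> X \<and> f \<in> carrier ?F
    then if c then (x #> s, f \<otimes>\<^bsub>?F\<^esub> label x) else (x #> t, f) else (x, f))" for c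
  \<comment> \<open>As \<open>step\<close> fixes everything outside
    \<open>X \<times> carrier ?F\<close>, the relation is an equality of total functions, as
    \<open>fold_modular_eq\<close> requires.\<close>
  have step_s: "step True \<circ> step True = id"
    using label_inv label_closed
    by (auto simp: fun_eq_iff step_def st_closed s_s F.m_assoc)
  have step_t: "step False \<circ> step False \<circ> step False = id"
    by (auto simp: fun_eq_iff step_def st_closed t_t_t)
  define act where "act w = fold step w" for w
  have act_eq: "act u = act v" if "ev u = ev v" for u v
    unfolding act_def by (rule fold_modular_eq[OF modular_eq_if_ev_eq[OF that] step_s step_t])
  have act_append: "act (u @ v) y = act v (act u y)" for u v y
    by (simp add: act_def)
  \<comment> \<open>\<open>J\<close> turns each step into right multiplication by the corresponding
    generator. It is \<one> at the base point, so a closed path spelling \<open>h\<close> ends at a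
    free word with value \<open>h\<close>.\<close>
  define J where "J = (\<lambda>(x, f). ?ev f \<otimes> rep x)"
  have step_J: "step c y \<in> X \<times> carrier ?F \<and> J (step c y) = J y \<otimes> (if c then s else t) \<and>
      fst (step c y) = fst y #> (if c then s else t)"
    if "y \<in> X \<times> carrier ?F" for c y
  proof -
    obtain x f where y: "y = (x, f)" "x \<in> X" "f \<in> carrier ?F" using \<open>y \<in> _\<close> by auto
    have xs: "x #> s \<in> X" using y st_closed by blast
    note cl = rep(1)[OF y(2)] rep(1)[OF xs] psi_closed[OF y(3)]
    have "?ev f \<otimes> (rep x \<otimes> s \<otimes> inv (rep (x #> s))) \<otimes> rep (x #> s) = ?ev f \<otimes> rep x \<otimes> s"
      using cl by (simp add: m_assoc)
    then show ?thesis
      using y label_closed psi_mult psi_label st_closed rep cl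
      by (auto simp: step_def J_def m_assoc)
  qed
  have act_J: "act w y \<in> X \<times> carrier ?F \<and> J (act w y) = J y \<otimes> ev w \<and> fst (act w y) = fst y #> ev w"
    if "y \<in> X \<times> carrier ?F" for w y
    using that
  proof (induction w arbitrary: y)
    case Nil
    then show ?case using rep psi_closed by (auto simp: act_def J_def coset_one)
  next
    case (Cons c w)
    have "J y \<in> carrier G" "fst y \<in> X" using Cons.prems rep psi_closed by (auto simp: J_def)
    then show ?case using step_J[OF Cons.prems, of c] Cons.IH[of "step c y"] coset_mult
      by (auto simp: act_def m_assoc)
  qed
  \<comment> \<open>Labels multiply the fibre coordinate on the right, so left translations of the
    fibre commute with the action; this makes \<open>\<phi>\<close> multiplicative.\<close>
  have act_left: "act w (x, g \<otimes>\<^bsub>?F\<^esub> f) = (fst (act w (x, f)), g \<otimes>\<^bsub>?F\<^esub> snd (act w (x, f)))"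
    if "x \<in> X" "f \<in> carrier ?F" "g \<in> carrier ?F" for w x f g
    using that
  proof (induction w arbitrary: x f)
    case (Cons c w)
    then show ?case
      using label_closed st_closed by (auto simp: act_def step_def F.m_assoc)
  qed (simp add: act_def)
  define word where "word g = (SOME w. ev w = g)" for g
  have word: "ev (word g) = g" if "g \<in> carrier G" for g
    unfolding word_def by (rule someI_ex[OF word_eval_surj[OF that]])
  have act_gen: "act (word (g \<otimes> (if c then s else t))) (H, f) = step c (x, f)"
    if "g \<in> carrier G" "act (word g) (H, f) = (x, f)" for g f x c
  proof -
    have "act (word (g \<otimes> (if c then s else t))) = act (word g @ [c])"
      using that(1) by (intro act_eq) (simp add: ev_append word)
    then show ?thesis using that(2) by (simp add: act_append) (simp add: act_def)
  qed
  have act_t: "act (word (g \<otimes> t)) (H, f) = (x #> t, f)"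
    if "x \<in> X" "g \<in> carrier G" "f \<in> carrier ?F" "act (word g) (H, f) = (x, f)" for g f x
    using act_gen[OF that(2,4), of False] that by (simp add: step_def)
  have act_s: "act (word (g \<otimes> s)) (H, f) = (x #> s, f)"
    if "x \<in> T" "g \<in> carrier G" "f \<in> carrier ?F" "act (word g) (H, f) = (x, f)" for g f x
    using act_gen[OF that(2,4), of True] that TX(1) F.r_one[of f] F_one
    by (auto simp: step_def label_def)
  have act_orbit3: "act (word (upd3 q x g y)) (H, f) = (y, f)"
    if "x \<in> X" "g \<in> carrier G" "y \<in> orbit3 x" "f \<in> carrier ?F" "act (word g) (H, f) = (x, f)"
    for q x g y f
    using that act_t[of x g f] act_t[of "x #> t" "g \<otimes> t" f] st_closed[of x]
    by (auto simp: orbit3_def upd3_def)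
  \<comment> \<open>Paths in the tree leave the fibre coordinate unchanged. The induction runs over
    partial trees \<open>S\<close>, while the labels refer to the final tree \<open>T\<close>; hence
    the condition \<open>S \<subseteq> T\<close>.\<close>
  have tree_act: "act (word (q x)) (H, f) = (x, f)"
    if "spanning D S q" "S \<subseteq> T" "x \<in> D" "f \<in> carrier ?F" for D S q x f
    using that
  proof (induction arbitrary: x)
    case root
    have "ev (word \<one>) = ev []" by (simp add: word)
    then have "act (word \<one>) (H, f) = (H, f)" using act_eq[of "word \<one>" "[]"] by (simp add: act_def)
    then show ?case using root act_orbit3[OF H_coset one_closed] by blast
  next
    case (grow D S q y)
    note gp = spanning_props[OF grow.hyps(1)]
    show ?case
    proof (cases "x \<in> orbit3 (y #> s)")
      case True
      have y: "y \<in> X" "q y \<in> carrier G" "y \<in> T" using gp grow.hyps grow.prems(1) by auto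
      then have "act (word (q y \<otimes> s)) (H, f) = (y #> s, f)"
        using act_s grow by auto
      then show ?thesis using True y grow.prems act_orbit3 st_closed by simp
    next
      case False
      then show ?thesis using grow by (auto simp: upd3_other)
    qed
  qed

  \<comment> \<open>The homomorphism reading off the free word, and its inverse\<close>
  define \<phi> where "\<phi> h = snd (act (word h) (H, []))" for h
  have nil: "[] \<in> carrier ?F" by (simp add: free_group_def)
  have sub_cl: "h \<in> carrier G" if "h \<in> H" for h
    using subgroup.mem_carrier[OF sub that] .
  have act_H: "act (word h) (H, []) = (H, \<phi> h)" "\<phi> h \<in> carrier ?F" "?ev (\<phi> h) = h" if "h \<in> H" for h
  proof -
    have h: "h \<in> carrier G" "H #> h = H" using that sub_cl coset_join2[OF _ sub] by auto
    show act: "act (word h) (H, []) = (H, \<phi> h)"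
      using act_J[of "(H, [])" "word h"] H_coset nil h word[OF h(1)] by (auto simp: \<phi>_def prod_eq_iff)
    then show "\<phi> h \<in> carrier ?F"
      using act_J[of "(H, [])" "word h"] H_coset nil by auto
    then show "?ev (\<phi> h) = h"
      using act_J[of "(H, [])" "word h"] H_coset nil act word[OF h(1)] repH psi_closed h
      by (auto simp: J_def)
  qed
  have phi_mult: "\<phi> (g \<otimes> h) = \<phi> g \<otimes>\<^bsub>?F\<^esub> \<phi> h" if "g \<in> H" "h \<in> H" for g h
  proof -
    have "act (word (g \<otimes> h)) = act (word g @ word h)"
      using that sub_cl by (intro act_eq) (simp add: ev_append word)
    then have "act (word (g \<otimes> h)) (H, []) = act (word h) (H, \<phi> g \<otimes>\<^bsub>?F\<^esub> [])"
      using act_H that F.r_one F_one by (simp add: act_append)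
    then show ?thesis
      using act_left[OF H_coset nil act_H(2)[OF that(1)]] by (simp add: \<phi>_def)
  qed
  have phi_label: "?ev (label x) \<in> H \<and> \<phi> (?ev (label x)) = label x" if x: "x \<in> X" for x
  proof -
    have xs: "x #> s \<in> X" using x st_closed by blast
    let ?g = "rep x \<otimes> s \<otimes> inv (rep (x #> s))"
    let ?w = "word (rep x) @ [True] @ word (inv (rep (x #> s)))"
    note cl = rep(1)[OF x] rep(1)[OF xs]
    have evw: "ev ?w = ?g" using cl by (simp add: ev_append word m_assoc)
    have "H #> ?g = H"
      using coset_mult[OF H_coset] coset_mult_closed rep(2)[OF x] rep(2)[OF xs] cl
      by (metis H_coset inv_closed m_closed r_inv s_closed coset_one)
    then have gH: "?g \<in> H" using coset_join1[OF _ _ sub] cl by simp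
    \<comment> \<open>The way back undoes the tree path to \<open>x #> s\<close>, taken with fibre
      coordinate \<open>label x\<close>; for this \<open>tree_act\<close> admits an arbitrary
      \<open>f\<close>. Only the crossing of the edge contributes a letter.\<close>
    have "act (word (rep (x #> s)) @ word (inv (rep (x #> s)))) = act []"
      using cl by (intro act_eq) (simp add: ev_append word)
    then have "act (word (inv (rep (x #> s)))) (act (word (rep (x #> s))) (H, label x)) = (H, label x)"
      unfolding act_append[symmetric] by (simp add: act_def)
    moreover have "act (word (rep (x #> s))) (H, label x) = (x #> s, label x)"
      using tree_act[OF sp subset_refl xs label_closed[OF x]] .
    ultimately have "act (word (inv (rep (x #> s)))) (x #> s, label x) = (H, label x)" by simp
    moreover have "act (word (rep x)) (H, []) = (x, [])"
      using tree_act[OF sp subset_refl x nil] .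
    moreover have "act [True] (x, []) = (x #> s, label x)"
      using x nil label_closed[OF x] F.l_one F_one by (simp add: act_def step_def)
    ultimately have "act ?w (H, []) = (H, label x)" by (simp only: act_append)
    moreover have "act (word ?g) = act ?w"
      using cl evw by (intro act_eq) (simp add: word)
    ultimately show ?thesis using gH by (simp add: psi_label[OF x] \<phi>_def)
  qed
  have phi_psi: "?ev w \<in> H \<and> \<phi> (?ev w) = w" if "w \<in> carrier ?F" for w
    using that
  proof (induction w)
    case Nil
    have "ev (word \<one>) = ev []" by (simp add: word)
    then have "act (word \<one>) (H, []) = (H, [])" using act_eq[of "word \<one>" "[]"] by (simp add: act_def)
    then show ?case by (simp add: \<phi>_def subgroup.one_closed[OF sub])
  next
    case (Cons l w)
    obtain i p where l: "l = (i, p)" by fastforce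
    have red: "reduced (l # w)" and w: "w \<in> carrier ?F" and i: "i < r"
      using Cons.prems l by (auto simp: free_group_def reduced_Cons)
    obtain e where e: "e \<in> E" "b e = i"
      using b i by (metis bij_betwE bij_betw_inv_into bij_betw_inv_into_right lessThan_iff)
    then obtain x where x: "x \<in> X - T" "e = {x, x #> s}" by (auto simp: E_def)
    \<comment> \<open>The end of the edge from which crossing it reads the letter
      \<open>l\<close>.\<close>
    define y where "y = (if p then ori e else ori e #> s)"
    have "y = x \<or> y = x #> s" using ori[of x] x s_s by (auto simp: y_def)
    then have y: "y \<in> X - T" "e = {y, y #> s}"
      using x Ts[of x] st_closed s_s[of x] by auto
    moreover have "(y = ori e) = p"
    proof -
      have "ori e \<in> X" using ori[of y] y st_closed by auto
      then show ?thesis using s_free by (auto simp: y_def)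
    qed
    ultimately have lab: "label y = [l]" using e l by (simp add: label_def)
    have yl: "?ev [l] \<in> H" "\<phi> (?ev [l]) = [l]" using phi_label[of y] y lab by auto
    have lF: "[l] \<in> carrier ?F" using label_closed[of y] y lab by auto
    have mult: "[l] \<otimes>\<^bsub>?F\<^esub> w = l # w"
      using free_reduce_id[OF red] by (simp add: F_mult)
    then have "?ev (l # w) = ?ev [l] \<otimes> ?ev w"
      using psi_mult[OF lF w] by simp
    then show ?case
      using yl Cons.IH[OF w] phi_mult mult subgroup.m_closed[OF sub] by metis
  qed
  have "\<phi> \<in> iso (G\<lparr>carrier := H\<rparr>) ?F"
    unfolding iso_def bij_betw_def
  proof (intro CollectI conjI)
    show "\<phi> \<in> hom (G\<lparr>carrier := H\<rparr>) ?F"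
      using act_H phi_mult by (auto simp: hom_def)
    show "inj_on \<phi> (carrier (G\<lparr>carrier := H\<rparr>))"
      using act_H(3) by (intro inj_on_inverseI[of _ ?ev]) auto
    show "\<phi> ` carrier (G\<lparr>carrier := H\<rparr>) = carrier ?F"
      using act_H(2) phi_psi by (auto simp: image_iff) metis
  qed
  then show ?thesis
    using subgroup_imp_group[OF sub] cE by (auto simp: free_of_rank_def is_iso_def r_def)
qed

end

section \<open>The presentation of the modular group\<close>

text \<open>The square of \<open>SL_s\<close> and the cube of \<open>SL_t\<close> are both
  \<open>- mat 1\<close>, so the images in \<open>PSL2Z\<close> have orders 2 and 3.\<close>

definition SL_s :: "int ^ 2 ^ 2" where "SL_s = vector [vector [0, -1], vector [1, 0]]"
definition SL_t :: "int ^ 2 ^ 2" where "SL_t = vector [vector [0, -1], vector [1, 1]]"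

lemma SL_s_nth [simp]: "SL_s $ 1 $ 1 = 0" "SL_s $ 1 $ 2 = -1" "SL_s $ 2 $ 1 = 1" "SL_s $ 2 $ 2 = 0"
  and SL_t_nth [simp]: "SL_t $ 1 $ 1 = 0" "SL_t $ 1 $ 2 = -1" "SL_t $ 2 $ 1 = 1" "SL_t $ 2 $ 2 = 1"
  by (simp_all add: SL_s_def SL_t_def)

lemmas mat2_simps = mat2_eq_iff mat2_mult mat2_one

lemma mat2_mult_minus [simp]: "A ** (- B) = - (A ** B)" "(- A) ** B = - (A ** B)"
  for A B :: "int ^ 2 ^ 2"
  by (simp_all add: mat2_simps)

lemma SL_s_carrier: "SL_s \<in> carrier SL2Z" and SL_t_carrier: "SL_t \<in> carrier SL2Z"
  by (simp_all add: SL2Z_def det_2)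

lemma SL2Z_simps [simp]: "A \<otimes>\<^bsub>SL2Z\<^esub> B = A ** B" "\<one>\<^bsub>SL2Z\<^esub> = mat 1"
  by (simp_all add: SL2Z_def)

lemma SL2Z_carrier_iff: "A \<in> carrier SL2Z \<longleftrightarrow> A $ 1 $ 1 * A $ 2 $ 2 - A $ 1 $ 2 * A $ 2 $ 1 = 1"
  by (simp add: SL2Z_def det_2)

section \<open>Generation of \<open>SL2Z\<close>\<close>

interpretation SL2Z: group SL2Z by (rule group_SL2Z)

abbreviation "sl_eval \<equiv> word_eval SL2Z SL_s SL_t"

lemma sl_eval_Nil [simp]: "sl_eval [] = mat 1"
  and sl_eval_Cons [simp]: "sl_eval (b # w) = (if b then SL_s else SL_t) ** sl_eval w"
  by (simp_all add: word_eval_def)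

lemma sl_eval_append: "sl_eval (v @ w) = sl_eval v ** sl_eval w"
  by (induction v) (auto simp: matrix_mul_assoc)

lemma sl_eval_carrier: "sl_eval w \<in> carrier SL2Z"
  using SL2Z.m_closed SL_s_carrier SL_t_carrier SL2Z.one_closed by (induction w) auto

definition sl_words :: "(int ^ 2 ^ 2) set" where "sl_words = range sl_eval"

lemma sl_words_mult: "A \<in> sl_words \<Longrightarrow> B \<in> sl_words \<Longrightarrow> A ** B \<in> sl_words"
  by (auto simp: sl_words_def sl_eval_append[symmetric])

lemma sl_words_s: "SL_s \<in> sl_words" and sl_words_t: "SL_t \<in> sl_words"
  using rangeI[of sl_eval "[True]"] rangeI[of sl_eval "[False]"] by (auto simp: sl_words_def)

definition upper :: "int \<Rightarrow> int ^ 2 ^ 2" where "upper k = vector [vector [1, k], vector [0, 1]]"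
definition lower :: "int \<Rightarrow> int ^ 2 ^ 2" where "lower k = vector [vector [1, 0], vector [k, 1]]"

lemma upper_nth [simp]: "upper k $ 1 $ 1 = 1" "upper k $ 1 $ 2 = k" "upper k $ 2 $ 1 = 0" "upper k $ 2 $ 2 = 1"
  and lower_nth [simp]: "lower k $ 1 $ 1 = 1" "lower k $ 1 $ 2 = 0" "lower k $ 2 $ 1 = k" "lower k $ 2 $ 2 = 1"
  by (simp_all add: upper_def lower_def)

lemma sl_words_minus: "A \<in> sl_words \<Longrightarrow> - A \<in> sl_words"
proof -
  have "- A = SL_s ** SL_s ** A" by (simp add: mat2_simps)
  then show "A \<in> sl_words \<Longrightarrow> - A \<in> sl_words" by (metis sl_words_mult sl_words_s)
qed

text \<open>Up to sign, \<open>upper 1\<close> and its inverse are short words; their powers give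
  every \<open>upper k\<close>, and conjugation by \<open>SL_s\<close> turns these into the lower
  matrices.\<close>

lemma sl_words_unipotent: "upper k \<in> sl_words" "lower k \<in> sl_words"
proof -
  have one: "upper 1 = - (SL_s ** SL_t)" "upper (-1) = - (SL_t ** SL_t ** SL_s)"
    by (simp_all add: mat2_simps)
  then have one: "upper 1 \<in> sl_words" "upper (-1) \<in> sl_words"
    using sl_words_minus sl_words_mult sl_words_s sl_words_t by simp_all
  show upper: "upper k \<in> sl_words" for k
  proof (induction k rule: int_induct[where k = 0])
    case base
    have "upper 0 = sl_eval []" by (simp add: mat2_simps)
    then show ?case unfolding sl_words_def by blast
  next
    case (step1 i)
    have "upper (i + 1) = upper i ** upper 1" by (simp add: mat2_simps)
    then show ?case using step1 one sl_words_mult by simp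
  next
    case (step2 i)
    have "upper (i - 1) = upper i ** upper (-1)" by (simp add: mat2_simps)
    then show ?case using step2 one sl_words_mult by simp
  qed
  have "lower k = - (SL_s ** upper (- k) ** SL_s)" by (simp add: mat2_simps)
  then show "lower k \<in> sl_words"
    using sl_words_minus sl_words_mult sl_words_s upper by simp
qed

text \<open>The subtractive Euclidean algorithm on the first column: row operations decrease |a| +
  |c| until an entry vanishes. What remains is unipotent up to sign, possibly after multiplication
  by \<open>SL_s\<close>.\<close>

lemma SL2Z_words: "A \<in> carrier SL2Z \<Longrightarrow> A \<in> sl_words"
proof (induction "nat (\<bar>A $ 1 $ 1\<bar> + \<bar>A $ 2 $ 1\<bar>)" arbitrary: A rule: less_induct)
  case less
  let ?a = "A $ 1 $ 1" and ?c = "A $ 2 $ 1"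
  have det: "?a * A $ 2 $ 2 - A $ 1 $ 2 * ?c = 1" using less.prems by (simp add: SL2Z_carrier_iff)
  have red: "A \<in> sl_words" if "B ** A \<in> sl_words" "adj2 B \<in> sl_words" "det B = 1" for B
  proof -
    have "A = adj2 B ** (B ** A)" using that by (simp add: matrix_mul_assoc adj2_mult)
    then show ?thesis using sl_words_mult[OF that(2,1)] by simp
  qed
  have unip: "adj2 (upper k) = upper (- k)" "adj2 (lower k) = lower (- k)"
    "det (upper k) = 1" "det (lower k) = 1" for k
    by (simp_all add: mat2_simps adj2_nth det_2)
  have s: "adj2 SL_s = - SL_s" "det SL_s = 1" by (simp_all add: mat2_simps adj2_nth det_2)
  have c0: "B \<in> sl_words" if "B \<in> carrier SL2Z" "B $ 2 $ 1 = 0" for B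
  proof -
    have *: "B $ 1 $ 1 * B $ 2 $ 2 = 1" using that by (simp add: SL2Z_carrier_iff)
    then consider "B $ 1 $ 1 = 1" "B $ 2 $ 2 = 1" | "B $ 1 $ 1 = -1" "B $ 2 $ 2 = -1"
      using zmult_eq_1_iff by metis
    then have "B = upper (B $ 1 $ 2) \<or> B = - upper (- (B $ 1 $ 2))"
      using that by cases (auto simp: mat2_simps)
    then show ?thesis using sl_words_unipotent sl_words_minus by metis
  qed
  consider "?c = 0" | "?a = 0" "?c \<noteq> 0" | "?a \<noteq> 0" "?c \<noteq> 0" "\<bar>?c\<bar> \<le> \<bar>?a\<bar>"
    | "?a \<noteq> 0" "?c \<noteq> 0" "\<bar>?a\<bar> < \<bar>?c\<bar>" by linarith
  then show ?case
  proof cases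
    case 1
    then show ?thesis using c0 less.prems by blast
  next
    case 2
    have "SL_s ** A \<in> carrier SL2Z" using less.prems SL_s_carrier SL2Z.m_closed by fastforce
    then have "SL_s ** A \<in> sl_words" using 2 by (intro c0) (auto simp: mat2_mult)
    then show ?thesis using s by (intro red[of SL_s]) (auto simp: sl_words_minus sl_words_s)
  next
    case 3
    \<comment> \<open>The sign for which |a + k c| = |a| - |c|.\<close>
    define k where "k = - (sgn ?a * sgn ?c)"
    have "upper k ** A \<in> sl_words"
    proof (rule less.hyps)
      show "upper k ** A \<in> carrier SL2Z"
        using less.prems unip by (simp add: SL2Z_def det_mul)
      show "nat (\<bar>(upper k ** A) $ 1 $ 1\<bar> + \<bar>(upper k ** A) $ 2 $ 1\<bar>) < nat (\<bar>?a\<bar> + \<bar>?c\<bar>)"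
        using 3 by (auto simp: mat2_mult k_def sgn_if)
    qed
    then show ?thesis using unip by (intro red[of "upper k"]) (auto simp: sl_words_unipotent)
  next
    case 4
    define k where "k = - (sgn ?a * sgn ?c)"
    have "lower k ** A \<in> sl_words"
    proof (rule less.hyps)
      show "lower k ** A \<in> carrier SL2Z"
        using less.prems unip by (simp add: SL2Z_def det_mul)
      show "nat (\<bar>(lower k ** A) $ 1 $ 1\<bar> + \<bar>(lower k ** A) $ 2 $ 1\<bar>) < nat (\<bar>?a\<bar> + \<bar>?c\<bar>)"
        using 4 by (auto simp: mat2_mult k_def sgn_if)
    qed
    then show ?thesis using unip by (intro red[of "lower k"]) (auto simp: sl_words_unipotent)
  qed
qed

text \<open>The products \<open>s t\<close> and \<open>s t t\<close> are, up to sign, the elementary unipotent matrices, so that no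
  cancellation can occur between the factors of such a word.\<close>

inductive positive_word :: "bool list \<Rightarrow> bool"
  where
    "positive_word []"
  | "positive_word w \<Longrightarrow> positive_word (True # False # w)"
  | "positive_word w \<Longrightarrow> positive_word (True # False # False # w)"

section \<open>Normal forms of words\<close>

lemma modular_eq_Cons: "modular_eq v w \<Longrightarrow> modular_eq (b # v) (b # w)"
  using modular_eq_append_cong[of v w "[b]" "[]"] by simp

text \<open>Induction by prepending a letter. A new \<open>t\<close> raises \<open>i\<close> modulo
  3. A new \<open>s\<close> forms a positive factor with the leading power of \<open>t\<close>; if
  there is none, it cancels the first letter of \<open>p\<close>, or toggles the final
  \<open>s\<close> when \<open>p\<close> is empty.\<close>

lemma modular_eq_normal_form:
  "\<exists>i j p. i < 3 \<and> j < 2 \<and> positive_word p \<and>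
    modular_eq w (replicate i False @ p @ replicate j True)"
proof (induction w)
  case Nil
  show ?case
    by (rule exI[of _ 0], rule exI[of _ 0], rule exI[of _ "[]"])
      (auto intro: positive_word.intros modular_eq.equiv_refl)
next
  case (Cons b w)
  then obtain i j p where h: "i < 3" "j < 2" "positive_word p"
    "modular_eq w (replicate i False @ p @ replicate j True)" by blast
  have eq: "modular_eq (b # w) (b # replicate i False @ p @ replicate j True)"
    by (rule modular_eq_Cons[OF h(4)])
  have via: ?case if "modular_eq (b # replicate i False @ p @ replicate j True)
      (replicate i' False @ p' @ replicate j' True)" "i' < 3" "j' < 2" "positive_word p'" for i' p' j'
    using modular_eq.equiv_trans[OF eq that(1)] that by blast
  show ?case
  proof (cases b)
    case False
    show ?thesis
    proof (cases "i = 2")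
      case True
      have "modular_eq ([] @ [False, False, False] @ p @ replicate j True) ([] @ p @ replicate j True)"
        by (rule modular_eq.cube)
      then show ?thesis using True False h by (intro via[of 0 p j]) (auto simp: numeral_2_eq_2)
    next
      case F: False
      then show ?thesis using False h by (intro via[of "Suc i" p j]) (auto intro: modular_eq.equiv_refl)
    qed
  next
    case True
    consider "i = 1" | "i = 2" | "i = 0" using h by linarith
    then show ?thesis
    proof cases
      case 1
      then show ?thesis using h True
        by (intro via[of 0 "True # False # p" j]) (auto intro: modular_eq.equiv_refl positive_word.intros)
    next
      case 2
      then show ?thesis using h True
        by (intro via[of 0 "True # False # False # p" j])
          (auto intro: modular_eq.equiv_refl positive_word.intros simp: numeral_2_eq_2)
    next
      case 3
      have cancel: "modular_eq (True # True # v) v" for v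
        using modular_eq.square[of "[]" v] by simp
      from h(3) show ?thesis
      proof cases
        case 1
        consider "j = 0" | "j = 1" using h by linarith
        then show ?thesis
        proof cases
          case 1
          then show ?thesis using \<open>p = []\<close> True \<open>i = 0\<close>
            by (intro via[of 0 "[]" 1]) (auto intro: modular_eq.equiv_refl positive_word.intros)
        next
          case 2
          then show ?thesis using \<open>p = []\<close> True \<open>i = 0\<close> cancel[of "[]"]
            by (intro via[of 0 "[]" 0]) (auto intro: modular_eq.equiv_refl positive_word.intros)
        qed
      next
        case (2 q)
        then show ?thesis using True h \<open>i = 0\<close> cancel by (intro via[of 1 q j]) auto
      next
        case (3 q)
        then show ?thesis using True h \<open>i = 0\<close> cancel
          by (intro via[of 2 q j]) (auto simp: numeral_2_eq_2)
      qed
    qed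
  qed
qed

definition pm_eq :: "int ^ 2 ^ 2 \<Rightarrow> int ^ 2 ^ 2 \<Rightarrow> bool"
  where "pm_eq A B \<longleftrightarrow> A = B \<or> A = - B"

lemma pm_eq_sl_eval:
  assumes "modular_eq v w"
  shows "pm_eq (sl_eval v) (sl_eval w)"
  using assms
proof induction
  case (square u v)
  have "SL_s ** (SL_s ** A) = - A" for A :: "int ^ 2 ^ 2" by (simp add: mat2_simps)
  then show ?case by (simp add: pm_eq_def sl_eval_append)
next
  case (cube u v)
  have "SL_t ** (SL_t ** (SL_t ** A)) = - A" for A :: "int ^ 2 ^ 2" by (simp add: mat2_simps)
  then show ?case by (simp add: pm_eq_def sl_eval_append)
qed (auto simp: pm_eq_def)

text \<open>Multiplying by \<open>upper 1\<close> or \<open>lower 1\<close> preserves the sign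
  conditions and makes an off-diagonal entry positive. The last conjunct separates nonempty words
  from the identity.\<close>

lemma positive_word_eval:
  assumes "positive_word p"
  shows "\<exists>A. pm_eq (sl_eval p) A \<and> A $ 1 $ 1 \<ge> 1 \<and> A $ 2 $ 2 \<ge> 1 \<and> A $ 1 $ 2 \<ge> 0 \<and> A $ 2 $ 1 \<ge> 0
    \<and> (p \<noteq> [] \<longrightarrow> A $ 1 $ 2 + A $ 2 $ 1 > 0)"
  using assms
proof induction
  case 1
  show ?case by (rule exI[of _ "mat 1"]) (simp add: pm_eq_def mat2_one)
next
  case (2 w)
  then obtain A where A: "pm_eq (sl_eval w) A" "A $ 1 $ 1 \<ge> 1 \<and> A $ 2 $ 2 \<ge> 1 \<and> A $ 1 $ 2 \<ge> 0 \<and> A $ 2 $ 1 \<ge> 0"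
    by blast
  have "SL_s ** (SL_t ** B) = - (upper 1 ** B)" for B :: "int ^ 2 ^ 2" by (simp add: mat2_simps)
  then have "pm_eq (sl_eval (True # False # w)) (upper 1 ** A)"
    using A(1) by (auto simp: pm_eq_def)
  with A(2) show ?case by (intro exI[of _ "upper 1 ** A"]) (simp add: mat2_mult)
next
  case (3 w)
  then obtain A where A: "pm_eq (sl_eval w) A" "A $ 1 $ 1 \<ge> 1 \<and> A $ 2 $ 2 \<ge> 1 \<and> A $ 1 $ 2 \<ge> 0 \<and> A $ 2 $ 1 \<ge> 0"
    by blast
  have "SL_s ** (SL_t ** (SL_t ** B)) = - (lower 1 ** B)" for B :: "int ^ 2 ^ 2" by (simp add: mat2_simps)
  then have "pm_eq (sl_eval (True # False # False # w)) (lower 1 ** A)"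
    using A(1) by (auto simp: pm_eq_def)
  with A(2) show ?case by (intro exI[of _ "lower 1 ** A"]) (simp add: mat2_mult)
qed

text \<open>Comparing entries for the six pairs \<open>(i, j)\<close> of the normal form, the signs
  of \<open>A\<close> leave only i = j = 0 with \<open>A\<close> diagonal, and then \<open>p\<close>
  is empty.\<close>

lemma modular_eq_Nil_if_pm_one:
  assumes "pm_eq (sl_eval w) (mat 1)"
  shows "modular_eq w []"
proof -
  obtain i j p where h: "i < 3" "j < 2" "positive_word p"
    "modular_eq w (replicate i False @ p @ replicate j True)" using modular_eq_normal_form by blast
  obtain A where A: "pm_eq (sl_eval p) A" "A $ 1 $ 1 \<ge> 1" "A $ 2 $ 2 \<ge> 1" "A $ 1 $ 2 \<ge> 0" "A $ 2 $ 1 \<ge> 0"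
    "p \<noteq> [] \<Longrightarrow> A $ 1 $ 2 + A $ 2 $ 1 > 0" using positive_word_eval[OF h(3)] by blast
  let ?Ti = "sl_eval (replicate i False)" and ?Sj = "sl_eval (replicate j True)"
  have "pm_eq (sl_eval w) (?Ti ** (sl_eval p ** ?Sj))"
    using pm_eq_sl_eval[OF h(4)] by (simp add: sl_eval_append)
  then have one: "pm_eq (?Ti ** (A ** ?Sj)) (mat 1)"
    using A(1) assms by (auto simp: pm_eq_def)
  have "i = 0 \<or> i = 1 \<or> i = 2" "j = 0 \<or> j = 1" using h by auto
  then have "i = 0 \<and> j = 0 \<and> A $ 1 $ 2 = 0 \<and> A $ 2 $ 1 = 0"
    using one A(2-5) by (auto simp: pm_eq_def mat2_simps numeral_2_eq_2)
  with A(6) h(4) show ?thesis by auto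
qed

section \<open>Passage to \<open>PSL2Z\<close>\<close>

interpretation PSL2Z: group PSL2Z by (rule group_PSL2Z)
interpretation proj: group_hom SL2Z PSL2Z PSL2Z_proj by (rule group_hom_PSL2Z_proj)

lemma PSL2Z_proj_eq: "PSL2Z_proj A = {A, - A}"
  by (auto simp: PSL2Z_proj_def r_coset_def)

lemma PSL2Z_proj_eq_iff: "PSL2Z_proj A = PSL2Z_proj B \<longleftrightarrow> pm_eq A B"
  unfolding PSL2Z_proj_eq pm_eq_def by (auto simp: doubleton_eq_iff)

lemma PSL2Z_carrier: "carrier PSL2Z = PSL2Z_proj ` carrier SL2Z"
  unfolding PSL2Z_def carrier_FactGroup PSL2Z_proj_def ..

lemma PSL2Z_eval: "word_eval PSL2Z (PSL2Z_proj SL_s) (PSL2Z_proj SL_t) w = PSL2Z_proj (sl_eval w)"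
proof (induction w)
  case Nil
  show ?case using proj.hom_one by (simp add: word_eval_def)
next
  case (Cons b w)
  have "PSL2Z_proj (A ** sl_eval w) = PSL2Z_proj A \<otimes>\<^bsub>PSL2Z\<^esub> PSL2Z_proj (sl_eval w)"
    if "A \<in> carrier SL2Z" for A
    using proj.hom_mult[OF that sl_eval_carrier[of w]] by simp
  then show ?case using Cons SL_s_carrier SL_t_carrier by (simp add: word_eval_def)
qed

lemma modular_presentation_PSL2Z:
  "modular_presentation PSL2Z (PSL2Z_proj SL_s) (PSL2Z_proj SL_t)"
proof unfold_locales
  let ?s = "PSL2Z_proj SL_s" and ?t = "PSL2Z_proj SL_t"
  show "?s \<in> carrier PSL2Z" "?t \<in> carrier PSL2Z"
    using SL_s_carrier SL_t_carrier by (auto simp: PSL2Z_carrier)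
  have one: "PSL2Z_proj A = \<one>\<^bsub>PSL2Z\<^esub> \<longleftrightarrow> pm_eq A (mat 1)" for A
    using proj.hom_one PSL2Z_proj_eq_iff[of A "mat 1"] by simp
  have "?s \<otimes>\<^bsub>PSL2Z\<^esub> ?s = PSL2Z_proj (SL_s ** SL_s)"
    using proj.hom_mult[OF SL_s_carrier SL_s_carrier] by simp
  also have "\<dots> = \<one>\<^bsub>PSL2Z\<^esub>" by (simp add: one pm_eq_def mat2_simps)
  finally show "?s \<otimes>\<^bsub>PSL2Z\<^esub> ?s = \<one>\<^bsub>PSL2Z\<^esub>" .
  have "?t \<otimes>\<^bsub>PSL2Z\<^esub> ?t \<otimes>\<^bsub>PSL2Z\<^esub> ?t = PSL2Z_proj (SL_t ** SL_t ** SL_t)"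
    using proj.hom_mult SL_t_carrier SL2Z.m_closed[OF SL_t_carrier SL_t_carrier] by simp
  also have "\<dots> = \<one>\<^bsub>PSL2Z\<^esub>" by (simp add: one pm_eq_def mat2_simps)
  finally show "?t \<otimes>\<^bsub>PSL2Z\<^esub> ?t \<otimes>\<^bsub>PSL2Z\<^esub> ?t = \<one>\<^bsub>PSL2Z\<^esub>" .
  show "\<exists>w. word_eval PSL2Z ?s ?t w = g" if g: "g \<in> carrier PSL2Z" for g
    using g SL2Z_words by (auto simp: PSL2Z_carrier PSL2Z_eval sl_words_def)
  show "modular_eq w []" if "word_eval PSL2Z ?s ?t w = \<one>\<^bsub>PSL2Z\<^esub>" for w
    using that modular_eq_Nil_if_pm_one by (simp add: PSL2Z_eval one)
qed

section \<open>Primitive pairs modulo \<open>m\<close>\<close>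

text \<open>For \<open>S\<close> the set of primes dividing \<open>m\<close> these are the primitive
  rows modulo \<open>m\<close>; a general \<open>S\<close> permits induction over the
  primes.\<close>

definition avoiding_pairs :: "nat set \<Rightarrow> nat \<Rightarrow> (nat \<times> nat) set"
  where "avoiding_pairs S m = {(a, b). a < m \<and> b < m \<and> (\<forall>p\<in>S. \<not> (p dvd a \<and> p dvd b))}"

lemma finite_avoiding_pairs [simp]: "finite (avoiding_pairs S m)"
  by (rule finite_subset[of _ "{..<m} \<times> {..<m}"]) (auto simp: avoiding_pairs_def)

text \<open>The pairs for \<open>S\<close> with both entries divisible by a further prime
  \<open>q\<close> are q times the pairs for \<open>S\<close> modulo m/q, so imposing
  \<open>q\<close> multiplies the count by 1 - 1/q^2.\<close>

lemma card_avoiding_pairs: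
  assumes "finite S" "\<And>p. p \<in> S \<Longrightarrow> prime p" "\<Prod>S dvd m" "0 < m"
  shows "real (card (avoiding_pairs S m)) = (real m)\<^sup>2 * (\<Prod>p\<in>S. 1 - 1 / (real p)\<^sup>2)"
  using assms
proof (induction S arbitrary: m rule: finite_induct)
  case empty
  have "avoiding_pairs {} m = {..<m} \<times> {..<m}" by (auto simp: avoiding_pairs_def)
  then show ?case by (simp add: power2_eq_square)
next
  case (insert q S)
  have q: "prime q" "0 < q" using insert.prems prime_gt_0_nat by auto
  have "q * \<Prod>S dvd m" using insert by simp
  then obtain k where k: "m = q * k" "\<Prod>S dvd k" "0 < k"
    using insert.prems(3) by (auto elim!: dvdE simp: mult.assoc intro: that)
  let ?A = "{(a, b) \<in> avoiding_pairs S m. q dvd a \<and> q dvd b}"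
  have pd: "p dvd q * x \<longleftrightarrow> p dvd x" if "p \<in> S" for p x
    using that insert q(1) by (metis insert_iff prime_dvd_mult_iff primes_dvd_imp_eq)
  have "?A = (\<lambda>(x, y). (q * x, q * y)) ` avoiding_pairs S k"
  proof (intro Set.set_eqI iffI)
    fix z assume z: "z \<in> ?A"
    then obtain x y where xy: "z = (q * x, q * y)" by (auto elim!: dvdE)
    then have "(x, y) \<in> avoiding_pairs S k"
      using z q(2) pd by (simp add: avoiding_pairs_def k(1))
    then show "z \<in> (\<lambda>(x, y). (q * x, q * y)) ` avoiding_pairs S k" using xy by force
  next
    fix z assume "z \<in> (\<lambda>(x, y). (q * x, q * y)) ` avoiding_pairs S k"
    then show "z \<in> ?A" using q(2) pd by (auto simp add: avoiding_pairs_def k(1))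
  qed
  moreover have "inj_on (\<lambda>(x, y). (q * x, q * y)) (avoiding_pairs S k)"
    using q(2) by (auto simp: inj_on_def)
  ultimately have "card ?A = card (avoiding_pairs S k)"
    by (simp add: card_image)
  moreover have "avoiding_pairs (insert q S) m = avoiding_pairs S m - ?A"
    by (auto simp: avoiding_pairs_def)
  moreover have sub: "?A \<subseteq> avoiding_pairs S m" by blast
  moreover have "finite ?A" "card ?A \<le> card (avoiding_pairs S m)"
    using finite_subset[OF sub] card_mono[OF _ sub] by simp_all
  ultimately have "real (card (avoiding_pairs (insert q S) m)) =
      real (card (avoiding_pairs S m)) - real (card (avoiding_pairs S k))"
    by (simp only: card_Diff_subset of_nat_diff)
  moreover have "\<Prod>S dvd m" using k by simp
  ultimately have "real (card (avoiding_pairs (insert q S) m)) =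
      (real m)\<^sup>2 * (\<Prod>p\<in>S. 1 - 1 / (real p)\<^sup>2) - (real k)\<^sup>2 * (\<Prod>p\<in>S. 1 - 1 / (real p)\<^sup>2)"
    using insert.IH[of m] insert.IH[of k] insert.prems k by simp
  also have "(real k)\<^sup>2 = (real m)\<^sup>2 / (real q)\<^sup>2" using q(2) k by (simp add: field_simps)
  finally show ?case using insert.hyps by (simp add: algebra_simps)
qed

text \<open>Used to complete a primitive row modulo \<open>m\<close> to an integer matrix of
  determinant 1.\<close>

lemma avoiding_pairs_lift:
  fixes m a b :: nat
  assumes "0 < m" "\<And>p. prime p \<Longrightarrow> p dvd m \<Longrightarrow> \<not> (p dvd a \<and> p dvd b)"
  shows "\<exists>a' b'. coprime a' b' \<and> [a' = a] (mod m) \<and> [b' = b] (mod m)"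
proof -
  \<comment> \<open>\<open>b + m\<close> rather than \<open>b\<close>, so that only finitely many primes have to be avoided when \<open>b = 0\<close>\<close>
  define b' where "b' = b + m"
  \<comment> \<open>A prime of \<open>b'\<close> dividing \<open>a\<close> divides neither
    \<open>m\<close> nor \<open>k\<close>, while one not dividing \<open>a\<close> divides
    \<open>k\<close>; in both cases it does not divide \<open>a + k * m\<close>.\<close>
  define k where "k = \<Prod>{p. prime p \<and> p dvd b' \<and> \<not> p dvd a}"
  define a' where "a' = a + k * m"
  have b': "b' > 0" using assms by (simp add: b'_def)
  have fin: "finite {p. prime p \<and> p dvd b' \<and> \<not> p dvd a}"
    by (rule finite_subset[OF _ finite_divisors_nat[OF b']]) auto
  have "\<not> p dvd a'" if p: "prime p" "p dvd b'" for p
  proof (cases "p dvd a")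
    case True
    then have "\<not> p dvd m" using assms(2)[OF p(1)] p(2) by (auto simp: b'_def dvd_add_left_iff)
    moreover have "\<not> p dvd k"
      unfolding k_def prime_dvd_prod_iff[OF fin p(1)]
      using True p(1) primes_dvd_imp_eq by auto
    ultimately show ?thesis
      using True p(1) by (simp add: a'_def dvd_add_right_iff prime_dvd_mult_iff)
  next
    case False
    then have "p dvd k" unfolding k_def using p fin by (intro dvd_prodI) auto
    then show ?thesis using False by (simp add: a'_def dvd_add_left_iff)
  qed
  then have "gcd a' b' = 1"
    using prime_factor_nat[of "gcd a' b'"] by auto
  then have "coprime a' b'" by (simp add: coprime_iff_gcd_eq_1)
  moreover have "[a' = a] (mod m)" "[b' = b] (mod m)"
    by (simp_all add: a'_def b'_def cong_def)
  ultimately show ?thesis by blast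
qed

lemma prod_primes_dvd:
  fixes m :: nat
  assumes "finite S" "\<And>p. p \<in> S \<Longrightarrow> prime p \<and> p dvd m"
  shows "\<Prod>S dvd m"
  using assms
proof (induction S rule: finite_induct)
  case (insert q S)
  have "coprime q (\<Prod>S)"
    using insert by (intro prod_coprime_right) (metis insert_iff primes_coprime)
  then show ?case using insert by (simp add: divides_mult)
qed simp

section \<open>Index and torsion of the congruence subgroups\<close>

lemma (in group) r_coset_eq_iff:
  assumes "subgroup H G" "a \<in> carrier G" "b \<in> carrier G"
  shows "H #> a = H #> b \<longleftrightarrow> a \<otimes> inv b \<in> H"
proof -
  have "H #> a = H #> b \<longleftrightarrow> a \<in> H #> b"
    using assms repr_independence[OF _ assms(3,1)] rcos_self[OF assms(2,1)] by auto
  also have "\<dots> \<longleftrightarrow> a \<otimes> inv b \<in> H"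
    by (rule subgroup.rcos_module[OF assms(1) is_group assms(3,2)])
  finally show ?thesis .
qed

lemma SL2Z_coset_eq_iff:
  assumes "subgroup \<Gamma> SL2Z" "A \<in> carrier SL2Z" "B \<in> carrier SL2Z"
  shows "\<Gamma> #>\<^bsub>SL2Z\<^esub> A = \<Gamma> #>\<^bsub>SL2Z\<^esub> B \<longleftrightarrow> A ** adj2 B \<in> \<Gamma>"
  using SL2Z.r_coset_eq_iff[OF assms] by (simp add: inv_SL2Z assms)

lemma adj2_carrier: "A \<in> carrier SL2Z \<Longrightarrow> adj2 A \<in> carrier SL2Z"
  by (simp add: SL2Z_def det_adj2)

lemma SL2Z_mult_carrier: "A \<in> carrier SL2Z \<Longrightarrow> B \<in> carrier SL2Z \<Longrightarrow> A ** B \<in> carrier SL2Z"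
  using SL2Z.m_closed by simp

lemma SL2Z_minus_carrier: "A \<in> carrier SL2Z \<Longrightarrow> - A \<in> carrier SL2Z"
  by (simp add: SL2Z_carrier_iff)

lemma mult_adj2: "A \<in> carrier SL2Z \<Longrightarrow> A ** adj2 A = mat 1"
  using SL2Z.r_inv[of A] by (simp add: inv_SL2Z)

lemma proj_image_iff: "PSL2Z_proj A \<in> PSL2Z_proj ` \<Gamma> \<longleftrightarrow> A \<in> \<Gamma> \<or> - A \<in> \<Gamma>"
  by (auto simp: image_iff PSL2Z_proj_eq_iff pm_eq_def) (metis minus_minus)

lemma PSL2Z_coset_eq_iff:
  assumes "subgroup \<Gamma> SL2Z" "A \<in> carrier SL2Z" "B \<in> carrier SL2Z"
  shows "(PSL2Z_proj ` \<Gamma>) #>\<^bsub>PSL2Z\<^esub> PSL2Z_proj A = (PSL2Z_proj ` \<Gamma>) #>\<^bsub>PSL2Z\<^esub> PSL2Z_proj B \<longleftrightarrow>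
    A ** adj2 B \<in> \<Gamma> \<or> - (A ** adj2 B) \<in> \<Gamma>"
proof -
  have "PSL2Z_proj A \<otimes>\<^bsub>PSL2Z\<^esub> inv\<^bsub>PSL2Z\<^esub> PSL2Z_proj B = PSL2Z_proj (A ** adj2 B)"
    using assms(2,3) proj.hom_mult[of A "adj2 B"] proj.hom_inv[of B]
    by (simp add: adj2_carrier inv_SL2Z)
  then show ?thesis
    using PSL2Z.r_coset_eq_iff[OF proj.subgroup_img_is_subgroup[OF assms(1)], of "PSL2Z_proj A" "PSL2Z_proj B"]
      assms(2,3) by (simp add: proj_image_iff)
qed

text \<open>Projection is two-to-one on cosets: a fibre consists of the cosets of \<open>A\<close>
  and \<open>- A\<close>, which differ because \<open>- mat 1 \<notin> \<Gamma>\<close>.\<close>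

lemma card_rcosets_PSL2Z:
  assumes "subgroup \<Gamma> SL2Z" "- mat 1 \<notin> \<Gamma>" "finite (rcosets\<^bsub>SL2Z\<^esub> \<Gamma>)"
  shows "finite (rcosets\<^bsub>PSL2Z\<^esub> (PSL2Z_proj ` \<Gamma>))"
    and "card (rcosets\<^bsub>SL2Z\<^esub> \<Gamma>) = 2 * card (rcosets\<^bsub>PSL2Z\<^esub> (PSL2Z_proj ` \<Gamma>))"
proof -
  let ?E = "rcosets\<^bsub>SL2Z\<^esub> \<Gamma>" and ?P = "PSL2Z_proj ` \<Gamma>"
  let ?F = "\<lambda>C. PSL2Z_proj ` C" and ?c = "\<lambda>A. \<Gamma> #>\<^bsub>SL2Z\<^esub> A"
  have sub: "\<Gamma> \<subseteq> carrier SL2Z" by (rule subgroup.subset[OF assms(1)])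
  have E: "?E = ?c ` carrier SL2Z" by (auto simp: RCOSETS_def)
  have F: "?F (?c A) = ?P #>\<^bsub>PSL2Z\<^esub> PSL2Z_proj A" if A: "A \<in> carrier SL2Z" for A
  proof -
    have "PSL2Z_proj (B ** A) = PSL2Z_proj B \<otimes>\<^bsub>PSL2Z\<^esub> PSL2Z_proj A" if "B \<in> \<Gamma>" for B
      using proj.hom_mult[of B A] that A sub by auto
    then show ?thesis by (force simp: r_coset_def)
  qed
  have "?F ` ?E = (\<lambda>A. ?P #>\<^bsub>PSL2Z\<^esub> PSL2Z_proj A) ` carrier SL2Z"
    unfolding E image_image by (rule image_cong[OF refl F])
  also have "\<dots> = rcosets\<^bsub>PSL2Z\<^esub> ?P"
    by (auto simp: RCOSETS_def PSL2Z_carrier)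
  finally have FE: "?F ` ?E = rcosets\<^bsub>PSL2Z\<^esub> ?P" .
  show "finite (rcosets\<^bsub>PSL2Z\<^esub> ?P)"
    unfolding FE[symmetric] using assms(3) by simp
  have "card ?E = (\<Sum>D\<in>?F ` ?E. card {C \<in> ?E. ?F C = D})"
    using sum.image_gen[OF assms(3), of "\<lambda>_. 1::nat" ?F] by simp
  also have "\<dots> = (\<Sum>D\<in>?F ` ?E. 2)"
  proof (rule sum.cong[OF refl])
    fix D assume "D \<in> ?F ` ?E"
    then obtain A where A: "A \<in> carrier SL2Z" "D = ?F (?c A)" by (auto simp: E)
    have "?F (?c B) = D \<longleftrightarrow> ?c B = ?c A \<or> ?c B = ?c (- A)" if "B \<in> carrier SL2Z" for B
    proof -
      have "B ** adj2 (- A) = - (B ** adj2 A)" by (simp add: mat2_simps adj2_nth)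
      then show ?thesis
        using PSL2Z_coset_eq_iff[OF assms(1) that A(1)] SL2Z_coset_eq_iff[OF assms(1) that A(1)]
          SL2Z_coset_eq_iff[OF assms(1) that SL2Z_minus_carrier[OF A(1)]]
        unfolding A(2) F[OF A(1)] F[OF that] by (simp only:)
    qed
    note fibre = this
    have "?F C = D \<longleftrightarrow> C = ?c A \<or> C = ?c (- A)" if "C \<in> ?E" for C
    proof -
      obtain B where "C = ?c B" "B \<in> carrier SL2Z" using \<open>C \<in> ?E\<close> unfolding E by (rule imageE)
      then show ?thesis using fibre[of B] by (simp only:)
    qed
    then have "{C \<in> ?E. ?F C = D} = {C \<in> ?E. C = ?c A \<or> C = ?c (- A)}"
      by (intro Collect_cong conj_cong refl)
    also have "\<dots> = {?c A, ?c (- A)}"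
    proof -
      have "?c A \<in> ?E" "?c (- A) \<in> ?E"
        unfolding E by (intro imageI A(1) SL2Z_minus_carrier)+
      then show ?thesis by (intro equalityI subsetI) (simp_all, elim disjE, simp_all)
    qed
    finally have eq: "{C \<in> ?E. ?F C = D} = {?c A, ?c (- A)}" .
    have "?c (- A) \<noteq> ?c A"
      using SL2Z_coset_eq_iff[OF assms(1) SL2Z_minus_carrier[OF A(1)] A(1)] mult_adj2[OF A(1)] assms(2)
      by simp
    then show "card {C \<in> ?E. ?F C = D} = 2"
      unfolding eq by (simp add: card_insert_if)
  qed
  finally show "card ?E = 2 * card (rcosets\<^bsub>PSL2Z\<^esub> ?P)" by (simp add: FE)
qed

section \<open>Congruences and the index of \<open>Gamma_set\<close>\<close>

lemma Gamma_set_cong: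
  assumes "A \<in> Gamma_set m n"
  shows "[A $ 1 $ 1 = 1] (mod int m)" "[A $ 2 $ 2 = 1] (mod int m)"
    "[A $ 1 $ 2 = 0] (mod int m)" "[A $ 2 $ 1 = 0] (mod int n)"
proof -
  show a: "[A $ 1 $ 1 = 1] (mod int m)" "[A $ 1 $ 2 = 0] (mod int m)" "[A $ 2 $ 1 = 0] (mod int n)"
    using assms by (auto simp: Gamma_set_def)
  \<comment> \<open>Reducing the determinant modulo \<open>m\<close> gives the lower right entry
    modulo \<open>m\<close>, which the trace argument uses.\<close>
  have "[A $ 1 $ 1 * A $ 2 $ 2 - A $ 1 $ 2 * A $ 2 $ 1 = 1 * A $ 2 $ 2 - 0 * A $ 2 $ 1] (mod int m)"
    by (intro cong_diff cong_mult cong_refl a)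
  then show "[A $ 2 $ 2 = 1] (mod int m)"
    using assms by (simp add: cong_sym_eq Gamma_set_def SL2Z_carrier_iff)
qed

text \<open>Unchanged by left multiplication with elements of \<open>Gamma_set m n\<close>, hence a
  function of the coset.\<close>

definition top_row :: "nat \<Rightarrow> int ^ 2 ^ 2 \<Rightarrow> nat \<times> nat"
  where "top_row m A = (nat (A $ 1 $ 1 mod int m), nat (A $ 1 $ 2 mod int m))"

lemma top_row_eq_iff:
  assumes "0 < m"
  shows "top_row m A = top_row m B \<longleftrightarrow>
    [A $ 1 $ 1 = B $ 1 $ 1] (mod int m) \<and> [A $ 1 $ 2 = B $ 1 $ 2] (mod int m)"
  using assms by (simp add: top_row_def cong_def eq_nat_nat_iff)

text \<open>A prime of \<open>m\<close> dividing both entries would divide the determinant.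
  Conversely, a primitive pair lifts to coprime integers, and Bezout coefficients supply the second
  row.\<close>

lemma top_row_surj:
  assumes "0 < m"
  shows "top_row m ` carrier SL2Z = avoiding_pairs {p. prime p \<and> p dvd m} m"
proof (intro Set.set_eqI iffI)
  fix z assume "z \<in> top_row m ` carrier SL2Z"
  then obtain A where A: "A \<in> carrier SL2Z" "z = top_row m A" by blast
  have "\<not> (p dvd nat (A $ 1 $ 1 mod int m) \<and> p dvd nat (A $ 1 $ 2 mod int m))"
    if p: "prime p" "p dvd m" for p
  proof
    assume "p dvd nat (A $ 1 $ 1 mod int m) \<and> p dvd nat (A $ 1 $ 2 mod int m)"
    then have "int p dvd A $ 1 $ 1 mod int m" "int p dvd A $ 1 $ 2 mod int m"
      using assms by (metis int_dvd_int_iff int_nat_eq of_nat_0_less_iff pos_mod_sign)+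
    then have "int p dvd A $ 1 $ 1" "int p dvd A $ 1 $ 2"
      using p(2) by (simp_all add: dvd_mod_iff)
    then have "int p dvd A $ 1 $ 1 * A $ 2 $ 2 - A $ 1 $ 2 * A $ 2 $ 1" by simp
    then show False using A(1) p(1) by (simp add: SL2Z_carrier_iff)
  qed
  then show "z \<in> avoiding_pairs {p. prime p \<and> p dvd m} m"
    using A(2) assms by (auto simp: top_row_def avoiding_pairs_def nat_less_iff)
next
  fix z assume "z \<in> avoiding_pairs {p. prime p \<and> p dvd m} m"
  then obtain a b where z: "z = (a, b)" "a < m" "b < m"
    "\<And>p. prime p \<Longrightarrow> p dvd m \<Longrightarrow> \<not> (p dvd a \<and> p dvd b)" by (auto simp: avoiding_pairs_def)
  obtain a' b' where ab: "coprime a' b'" "[a' = a] (mod m)" "[b' = b] (mod m)"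
    using avoiding_pairs_lift[OF assms z(4)] by blast
  obtain u v where uv: "u * int a' + v * int b' = 1"
    using bezout_int[of "int a'" "int b'"] ab(1) by (auto simp: coprime_iff_gcd_eq_1)
  let ?A = "vector [vector [int a', int b'], vector [- v, u]] :: int ^ 2 ^ 2"
  have "?A \<in> carrier SL2Z" using uv by (simp add: SL2Z_carrier_iff algebra_simps)
  moreover have "top_row m ?A = z"
    using ab z by (simp add: top_row_def cong_def flip: of_nat_mod)
  ultimately show "z \<in> top_row m ` carrier SL2Z" by blast
qed

text \<open>With a fixed lift \<open>B p\<close> of each primitive row \<open>p\<close>, the
  matrices \<open>lower (int k) ** B p\<close> for k < n represent every coset exactly once.\<close>

lemma card_rcosets_Gamma_set:
  assumes "0 < n" "0 < m" "n dvd m"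
  shows "finite (rcosets\<^bsub>SL2Z\<^esub> (Gamma_set m n))"
    and "card (rcosets\<^bsub>SL2Z\<^esub> (Gamma_set m n)) = card (avoiding_pairs {p. prime p \<and> p dvd m} m) * n"
proof -
  let ?P = "avoiding_pairs {p. prime p \<and> p dvd m} m"
  let ?c = "\<lambda>A. Gamma_set m n #>\<^bsub>SL2Z\<^esub> A"
  note sub = subgroup_Gamma_set[OF assms(3)]
  define B where "B = inv_into (carrier SL2Z) (top_row m)"
  have B: "B p \<in> carrier SL2Z \<and> top_row m (B p) = p" if "p \<in> ?P" for p
    using that f_inv_into_f inv_into_into unfolding B_def top_row_surj[OF assms(2), symmetric]
    by metis
  define R where "R = (\<lambda>(p, k). ?c (lower (int k) ** B p))"
  have lower: "lower k \<in> carrier SL2Z" for k by (simp add: SL2Z_carrier_iff)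
  have mono: "[x = y] (mod int n)" if "[x = y] (mod int m)" for x y
    using that assms(3) cong_dvd_modulus int_dvd_int_iff by blast
  have "bij_betw R (?P \<times> {..<n}) (rcosets\<^bsub>SL2Z\<^esub> (Gamma_set m n))"
    unfolding bij_betw_def
  proof
    show "inj_on R (?P \<times> {..<n})"
    proof (rule inj_onI)
      fix z z' assume z: "z \<in> ?P \<times> {..<n}" "z' \<in> ?P \<times> {..<n}" "R z = R z'"
      obtain p k p' k' where zz: "z = (p, k)" "z' = (p', k')" by fastforce
      have p: "p \<in> ?P" "p' \<in> ?P" and k: "k < n" "k' < n" and eq: "R (p, k) = R (p', k')"
        using z zz by auto
      let ?A = "lower (int k) ** B p" and ?A' = "lower (int k') ** B p'"
      have c: "?A \<in> carrier SL2Z" "?A' \<in> carrier SL2Z"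
        using B p lower SL2Z_mult_carrier by auto
      let ?D = "?A ** adj2 ?A'"
      have D: "?D \<in> Gamma_set m n" using eq SL2Z_coset_eq_iff[OF sub c] by (simp add: R_def)
      have "?A = ?D ** ?A'" using c by (simp add: matrix_mul_assoc[symmetric] adj2_mult SL2Z_def)
      then have "?A $ 1 $ j = ?D $ 1 $ 1 * ?A' $ 1 $ j + ?D $ 1 $ 2 * ?A' $ 2 $ j" for j
        by (metis mat2_mult)
      moreover have "[?D $ 1 $ 1 * ?A' $ 1 $ j + ?D $ 1 $ 2 * ?A' $ 2 $ j = 1 * ?A' $ 1 $ j + 0 * ?A' $ 2 $ j] (mod int m)" for j
        by (intro cong_add cong_mult cong_refl Gamma_set_cong[OF D])
      ultimately have "top_row m ?A = top_row m ?A'"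
        by (simp add: top_row_eq_iff[OF assms(2)])
      moreover have "top_row m (lower i ** C) = top_row m C" for i C
        by (simp add: top_row_def mat2_mult)
      ultimately have pp: "p = p'" using B p by metis
      then have "?D = lower (int k) ** (B p ** adj2 (B p)) ** adj2 (lower (int k'))"
        by (simp add: mat2_simps adj2_nth algebra_simps)
      also have "\<dots> = lower (int k - int k')"
        using B p by (simp add: mult_adj2) (simp add: mat2_simps adj2_nth)
      finally have "[int k - int k' = 0] (mod int n)" using Gamma_set_cong(4)[OF D] by simp
      then have "[int k = int k'] (mod int n)" using cong_diff_iff_cong_0 by blast
      then have "k = k'" using k by (simp add: cong_def flip: of_nat_mod)
      with pp show "z = z'" by (simp add: zz)
    qed
    show "R ` (?P \<times> {..<n}) = rcosets\<^bsub>SL2Z\<^esub> (Gamma_set m n)"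
    proof (intro Set.set_eqI iffI)
      fix C assume "C \<in> R ` (?P \<times> {..<n})"
      then show "C \<in> rcosets\<^bsub>SL2Z\<^esub> (Gamma_set m n)"
        using B lower SL2Z_mult_carrier by (auto simp: R_def RCOSETS_def)
    next
      fix C assume "C \<in> rcosets\<^bsub>SL2Z\<^esub> (Gamma_set m n)"
      then obtain A where A: "A \<in> carrier SL2Z" "C = ?c A" by (auto simp: RCOSETS_def)
      let ?p = "top_row m A"
      have p: "?p \<in> ?P" using A top_row_surj[OF assms(2)] by blast
      note Bp = B[OF p]
      let ?D = "A ** adj2 (B ?p)"
      have D: "?D \<in> carrier SL2Z" using A Bp SL2Z_mult_carrier adj2_carrier by blast
      \<comment> \<open>Multiplying \<open>?D\<close> by \<open>lower (- int k)\<close> subtracts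
        \<open>k\<close> times its lower right entry from the lower left one. As the former is 1
        modulo \<open>n\<close>, this residue makes the latter vanish modulo
        \<open>n\<close>.\<close>
      define k where "k = nat (?D $ 2 $ 1 mod int n)"
      have k: "int k = ?D $ 2 $ 1 mod int n" "k < n" using assms(1) by (auto simp: k_def nat_less_iff)
      have row: "[A $ 1 $ 1 = B ?p $ 1 $ 1] (mod int m)" "[A $ 1 $ 2 = B ?p $ 1 $ 2] (mod int m)"
        using Bp top_row_eq_iff[OF assms(2)] by metis+
      have "[A $ 1 $ 1 * B ?p $ 2 $ 2 + A $ 1 $ 2 * - (B ?p $ 2 $ 1)
          = B ?p $ 1 $ 1 * B ?p $ 2 $ 2 + B ?p $ 1 $ 2 * - (B ?p $ 2 $ 1)] (mod int m)"
        "[A $ 1 $ 1 * - (B ?p $ 1 $ 2) + A $ 1 $ 2 * B ?p $ 1 $ 1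
          = B ?p $ 1 $ 1 * - (B ?p $ 1 $ 2) + B ?p $ 1 $ 2 * B ?p $ 1 $ 1] (mod int m)"
        by (intro cong_add cong_mult cong_refl row)+
      moreover have "B ?p $ 1 $ 1 * B ?p $ 2 $ 2 + B ?p $ 1 $ 2 * - (B ?p $ 2 $ 1) = 1"
        using Bp by (simp add: SL2Z_carrier_iff)
      moreover have "B ?p $ 1 $ 1 * - (B ?p $ 1 $ 2) + B ?p $ 1 $ 2 * B ?p $ 1 $ 1 = 0"
        by simp
      ultimately have D1: "[?D $ 1 $ 1 = 1] (mod int m)" "[?D $ 1 $ 2 = 0] (mod int m)"
        by (simp_all only: mat2_mult adj2_nth)
      have "[?D $ 1 $ 1 * ?D $ 2 $ 2 - ?D $ 1 $ 2 * ?D $ 2 $ 1 = 1 * ?D $ 2 $ 2 - 0 * ?D $ 2 $ 1] (mod int m)"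
        by (intro cong_diff cong_mult cong_refl D1)
      then have D2: "[?D $ 2 $ 2 = 1] (mod int m)"
        using D by (simp add: SL2Z_carrier_iff cong_sym_eq)
      let ?M = "?D ** lower (- int k)"
      have "[?D $ 1 $ 1 + ?D $ 1 $ 2 * - int k = 1 + 0 * - int k] (mod int m)"
        by (intro cong_add cong_mult cong_refl D1)
      moreover have "[?D $ 2 $ 1 + ?D $ 2 $ 2 * - int k = ?D $ 2 $ 1 + 1 * - (?D $ 2 $ 1)] (mod int n)"
        by (intro cong_add cong_mult cong_refl mono[OF D2] iffD2[OF cong_minus_minus_iff])
          (simp add: k cong_def)
      moreover have "?M \<in> carrier SL2Z" using D lower SL2Z_mult_carrier by blast
      ultimately have M: "?M \<in> Gamma_set m n"
        using D1 mono[OF D2] by (simp add: Gamma_set_def) (simp add: mat2_mult[of ?D])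
      have "?M = A ** adj2 (lower (int k) ** B ?p)"
        by (simp add: mat2_simps adj2_nth algebra_simps)
      then have "?c A = ?c (lower (int k) ** B ?p)"
        using M SL2Z_coset_eq_iff[OF sub A(1) SL2Z_mult_carrier[OF lower Bp[THEN conjunct1]]] by simp
      then have "C = R (?p, k)" using A by (simp add: R_def)
      then show "C \<in> R ` (?P \<times> {..<n})" using p k by blast
    qed
  qed
  note bij = this
  show "finite (rcosets\<^bsub>SL2Z\<^esub> (Gamma_set m n))"
    using bij_betw_finite[OF bij] by simp
  show "card (rcosets\<^bsub>SL2Z\<^esub> (Gamma_set m n)) = card ?P * n"
    using bij_betw_same_card[OF bij] by (simp add: card_cartesian_product)
qed

text \<open>The traces of the elliptic elements of \<open>SL2Z\<close> are 0 and \<open>\<plusminus> 1\<close>.\<close>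

definition trace2 :: "int ^ 2 ^ 2 \<Rightarrow> int" where "trace2 A = A $ 1 $ 1 + A $ 2 $ 2"

lemma trace2_conj: "A \<in> carrier SL2Z \<Longrightarrow> trace2 (A ** B ** adj2 A) = trace2 B"
proof -
  assume A: "A \<in> carrier SL2Z"
  have "trace2 (A ** B ** adj2 A) = trace2 (adj2 A ** A ** B)"
    by (simp add: trace2_def mat2_mult algebra_simps)
  then show ?thesis using A by (simp add: adj2_mult SL2Z_def)
qed

lemma trace2_Gamma_set:
  assumes "A \<in> Gamma_set m n"
  shows "int m dvd trace2 A - 2"
  using cong_add[OF Gamma_set_cong(1,2)[OF assms]] by (simp add: trace2_def cong_iff_dvd_diff)

text \<open>The trace is 2 modulo \<open>m\<close>, so 0 and 1 are impossible and -1 forces m = 3.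
  In the excluded case (3, 1) the matrix with rows (1, 3) and (-1, -2) has trace -1.\<close>

lemma Gamma_set_elliptic_free:
  assumes "3 \<le> m" "n dvd m" "(m, n) \<noteq> (3, 1)" "A \<in> Gamma_set m n"
  shows "trace2 A \<noteq> 0" "\<bar>trace2 A\<bar> \<noteq> 1"
proof -
  note d = trace2_Gamma_set[OF assms(4)]
  show "trace2 A \<noteq> 0" using zdvd_imp_le[of "int m" 2] d assms(1) by auto
  show "\<bar>trace2 A\<bar> \<noteq> 1"
  proof
    assume "\<bar>trace2 A\<bar> = 1"
    then consider "trace2 A = 1" | "trace2 A = -1" by linarith
    then show False
    proof cases
      case 1
      then show False using zdvd_imp_le[of "int m" 1] d assms(1) by auto
    next
      case 2
      then have "m = 3" using zdvd_imp_le[of "int m" 3] d assms(1) by auto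
      moreover have "n = 1 \<or> n = 3"
        using assms(2) \<open>m = 3\<close> prime_nat_iff[of 3] by auto
      ultimately have m: "m = 3" "n = 3" using assms(3) by auto
      obtain x y where xy: "A $ 1 $ 1 = 1 + 3 * x" "A $ 2 $ 2 = 1 + 3 * y"
        using Gamma_set_cong(1,2)[OF assms(4)] m unfolding cong_iff_dvd_diff
        by (metis dvdE add.commute diff_add_cancel of_nat_numeral)
      obtain u v where uv: "A $ 1 $ 2 = 3 * u" "A $ 2 $ 1 = 3 * v"
        using Gamma_set_cong(3,4)[OF assms(4)] m unfolding cong_0_iff by (auto elim!: dvdE)
      have "A $ 1 $ 1 * A $ 2 $ 2 - A $ 1 $ 2 * A $ 2 $ 1 = 1"
        using assms(4) by (simp add: Gamma_set_def SL2Z_carrier_iff)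
      \<comment> \<open>The determinant equation makes x + y divisible by 3, whereas trace -1 means
        x + y = -1.\<close>
      then have "3 * (x + y) + 9 * (x * y - u * v) = 0" by (simp add: xy uv algebra_simps)
      moreover have "x + y = -1" using 2 by (simp add: trace2_def xy)
      ultimately show False by presburger
    qed
  qed
qed

lemma minus_one_notin_Gamma_set: "3 \<le> m \<Longrightarrow> - mat 1 \<notin> Gamma_set m n"
  using Gamma_set_cong(1)[of "- mat 1" m n] zdvd_imp_le[of "int m" 2]
  by (auto simp: cong_iff_dvd_diff mat2_one)

text \<open>If the coset of \<open>A\<close> is fixed by \<open>E\<close>, then the conjugate of
  \<open>E\<close> by \<open>A\<close> lies in the subgroup up to sign, and its trace is that of
  \<open>E\<close> up to sign.\<close>

lemma elliptic_coset_free: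
  assumes "3 \<le> m" "n dvd m" "(m, n) \<noteq> (3, 1)" "E \<in> carrier SL2Z" "trace2 E = 0 \<or> \<bar>trace2 E\<bar> = 1"
    and "x \<in> rcosets\<^bsub>PSL2Z\<^esub> (PSL2Z_proj ` Gamma_set m n)"
  shows "x #>\<^bsub>PSL2Z\<^esub> PSL2Z_proj E \<noteq> x"
proof
  assume eq: "x #>\<^bsub>PSL2Z\<^esub> PSL2Z_proj E = x"
  let ?P = "PSL2Z_proj ` Gamma_set m n"
  note sub = subgroup_Gamma_set[OF assms(2)]
  obtain A where A: "A \<in> carrier SL2Z" "x = ?P #>\<^bsub>PSL2Z\<^esub> PSL2Z_proj A"
    using assms(6) by (auto simp: RCOSETS_def PSL2Z_carrier)
  have "x #>\<^bsub>PSL2Z\<^esub> PSL2Z_proj E = ?P #>\<^bsub>PSL2Z\<^esub> PSL2Z_proj (A ** E)"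
    using A assms(4) PSL2Z.coset_mult_assoc[of ?P "PSL2Z_proj A" "PSL2Z_proj E"]
      subgroup.subset[OF subgroup_PGamma[OF assms(2)]] proj.hom_mult[of A E] by simp
  then have "A ** E ** adj2 A \<in> Gamma_set m n \<or> - (A ** E ** adj2 A) \<in> Gamma_set m n"
    using eq A PSL2Z_coset_eq_iff[OF sub SL2Z_mult_carrier[OF A(1) assms(4)] A(1)] by simp
  moreover have "trace2 (- B) = - trace2 B" for B by (simp add: trace2_def)
  ultimately show False
    using Gamma_set_elliptic_free[OF assms(1-3)] trace2_conj[OF A(1), of E] assms(5)
    by (metis abs_minus_cancel neg_equal_0_iff_equal)
qed

text \<open>The kernel of the projection is generated by \<open>- mat 1\<close>, which does not lie
  in \<open>Gamma_set m n\<close>; so the projection is injective there.\<close>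

lemma Gamma_group_iso_PGamma_group:
  assumes "3 \<le> m" "n dvd m"
  shows "PSL2Z_proj \<in> iso (Gamma_group m n) (PGamma_group m n)"
proof -
  note sub = subgroup_Gamma_set[OF assms(2)]
  have carr: "A \<in> carrier SL2Z" if "A \<in> Gamma_set m n" for A
    using that by (simp add: Gamma_set_def)
  have "inj_on PSL2Z_proj (Gamma_set m n)"
  proof (rule inj_onI)
    fix A B assume AB: "A \<in> Gamma_set m n" "B \<in> Gamma_set m n" "PSL2Z_proj A = PSL2Z_proj B"
    have "A \<noteq> - B"
    proof
      assume "A = - B"
      then have "A ** adj2 B = - mat 1" using AB carr mult_adj2 by simp
      moreover have "A ** adj2 B \<in> Gamma_set m n"
        using AB subgroup.m_closed[OF sub AB(1) subgroup.m_inv_closed[OF sub AB(2)]] carr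
        by (simp add: inv_SL2Z)
      ultimately show False using minus_one_notin_Gamma_set[OF assms(1)] by simp
    qed
    then show "A = B" using AB(3) by (simp add: PSL2Z_proj_eq_iff pm_eq_def)
  qed
  moreover have "PSL2Z_proj \<in> hom (Gamma_group m n) (PGamma_group m n)"
    using proj.hom_mult carr by (auto simp: hom_def Gamma_group_def PGamma_group_def)
  ultimately show ?thesis
    by (simp add: iso_def bij_betw_def Gamma_group_def PGamma_group_def)
qed

theorem proposition1p3:
  fixes m n :: nat
  assumes "0 < n" and "3 \<le> m" and "n dvd m" and "(m, n) \<noteq> (3, 1)"
  shows "\<exists>r::nat.
    real r = 1 + real n * (real m)\<^sup>2 / 12 *
      (\<Prod>p \<in> {p::nat. prime p \<and> p dvd m}. 1 - 1 / (real p)\<^sup>2) \<and>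
    free_of_rank (Gamma_group m n) r \<and>
    free_of_rank (PGamma_group m n) r"
proof -
  let ?P = "PSL2Z_proj ` Gamma_set m n" and ?S = "{p. prime p \<and> p dvd m}"
  have m: "0 < m" using assms(2) by simp
  note index = card_rcosets_Gamma_set[OF assms(1) m assms(3)]
  note PSL = card_rcosets_PSL2Z[OF subgroup_Gamma_set[OF assms(3)]
      minus_one_notin_Gamma_set[OF assms(2)] index(1)]
  interpret modular_presentation PSL2Z "PSL2Z_proj SL_s" "PSL2Z_proj SL_t"
    by (rule modular_presentation_PSL2Z)
  interpret modular_free_subgroup PSL2Z "PSL2Z_proj SL_s" "PSL2Z_proj SL_t" ?P
  proof (intro modular_free_subgroup.intro modular_presentation_axioms modular_free_subgroup_axioms.intro)
    show "subgroup ?P PSL2Z" by (rule subgroup_PGamma[OF assms(3)])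
    show "finite (rcosets\<^bsub>PSL2Z\<^esub> ?P)" by (rule PSL(1))
    show "x #>\<^bsub>PSL2Z\<^esub> PSL2Z_proj SL_s \<noteq> x" if "x \<in> rcosets\<^bsub>PSL2Z\<^esub> ?P" for x
      using elliptic_coset_free[OF assms(2-4) SL_s_carrier _ that] by (simp add: trace2_def)
    show "x #>\<^bsub>PSL2Z\<^esub> PSL2Z_proj SL_t \<noteq> x" if "x \<in> rcosets\<^bsub>PSL2Z\<^esub> ?P" for x
      using elliptic_coset_free[OF assms(2-4) SL_t_carrier _ that] by (simp add: trace2_def)
  qed
  obtain r where r: "6 * r = card (rcosets\<^bsub>PSL2Z\<^esub> ?P) + 6" "free_of_rank (PGamma_group m n) r"
    using free_of_rank_subgroup unfolding PGamma_group_def by blast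
  have S: "finite ?S" "\<Prod>?S dvd m"
  proof -
    show "finite ?S" using finite_divisors_nat[OF m] by (rule rev_finite_subset) auto
    then show "\<Prod>?S dvd m" by (rule prod_primes_dvd) auto
  qed
  \<comment> \<open>Twice the index in \<open>PSL2Z\<close> is the index in \<open>SL2Z\<close>, so
    doubling the rank formula gives 12 in place of 6.\<close>
  have "12 * r = n * card (avoiding_pairs ?S m) + 12" using r(1) PSL(2) index(2) by (simp add: mult.commute)
  then have "12 * real r = real n * real (card (avoiding_pairs ?S m)) + 12"
    by (metis of_nat_add of_nat_mult of_nat_numeral)
  then have "real r = 1 + real n * (real m)\<^sup>2 / 12 * (\<Prod>p\<in>?S. 1 - 1 / (real p)\<^sup>2)"
    using card_avoiding_pairs[OF S(1) _ S(2) m] by (simp add: field_simps)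
  moreover have "free_of_rank (Gamma_group m n) r"
    using r(2) group_Gamma_group[OF assms(3)] iso_trans[OF is_isoI[OF Gamma_group_iso_PGamma_group[OF assms(2,3)]]]
    by (auto simp: free_of_rank_def)
  ultimately show ?thesis using r(2) by blast
qed

end
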